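(* Consider the closed-loop switched stochastic system $$x(k+1)=A_{r(k)}x(k)+B_{r(k)}u(k),\qquad u(k)=K_{\sigma(k)}x(k),\qquad k\in\mathbb{N}_0,$$ with the setting described in the context. Suppose there exist a symmetric positive definite matrix $\tilde R\in\mathbb{R}^{n\times n}$, matrices $L_i\in\mathbb{R}^{m\times n}$, $i\in\mathcal{M}$, and scalars $\zeta_{i,j}\in(0,\infty)$, $i,j\in\mathcal{M}$, such that $$(A_i\tilde R+B_iL_j)^{\mathrm T}\tilde R^{-1}(A_i\tilde R+B_iL_j)-\zeta_{i,j}\tilde R\le 0\quad(\text{negative semidefinite}),\qquad i,j\in\mathcal{M},$$ and $$\sum_{\tau\in\mathbb{N}}\mu_\tau\sum_{l=1}^{\tau}\sum_{i,j\in\mathcal{M}}\pi_i\,p^{(l-1)}_{i,j}\ln\zeta_{j,i}<0 .$$ Then with feedback gains $K_i=L_i\tilde R^{-1}$, $i\in\mathcal{M}$, the zero solution $x(k)\equiv0$ of the closed-loop system is asymptotically stable almost surely.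
   Context: $\mathcal{M}=\{1,\dots,M\}$; $A_i\in\mathbb{R}^{n\times n}$, $B_i\in\mathbb{R}^{n\times m}$ are given. The mode signal $\{r(k)\in\mathcal{M}\}_{k\in\mathbb{N}_0}$ is an aperiodic irreducible discrete-time Markov chain with deterministic initial mode $r(0)=r_0$, transition probabilities $p_{i,j}$, $l$-step transition probabilities $p^{(l)}_{i,j}=\mathbb{P}[r(k+l)=j\mid r(k)=i]$ (entries of $P^l$, with $p^{(0)}_{i,j}=1$ if $i=j$ and $0$ otherwise), and invariant distribution $\pi$. The initial state $x(0)=x_0$ is deterministic. Mode observation instants $t_0=0<t_1<\dots$ are random with $\tau_i=t_i-t_{i-1}\in\mathbb{N}$, $i\in\mathbb{N}$, i.i.d. with distribution $\mathbb{P}[\tau_i=\tau]=\mu_\tau$ and $\hat\tau=\sum_\tau\tau\mu_\tau<\infty$; the counting process $N(k)=\sum_{i\in\mathbb{N}}\mathbb{1}[t_i\le k]$ is independent of $r$. The sampled mode is $\sigma(k)=r(t_{N(k)})$. The zero solution is almost surely stable if for all $\epsilon>0,\rho>0$ there is $\delta>0$ with $\|x(0)\|<\delta\Rightarrow \mathbb{P}[\sup_{k}\|x(k)\|>\epsilon]<\rho$; it is asymptotically stable almost surely if in addition $\mathbb{P}[\lim_{k\to\infty}\|x(k)\|=0]=1$. *)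

theory Defs
  imports "HOL-Probability.Probability"
begin

fun mstep :: "('i::finite \<Rightarrow> 'i \<Rightarrow> real) \<Rightarrow> nat \<Rightarrow> 'i \<Rightarrow> 'i \<Rightarrow> real" where
  "mstep p 0 i j = (if i = j then 1 else 0)"
| "mstep p (Suc l) i j = (\<Sum>k\<in>UNIV. mstep p l i k * p k j)"

definition stochastic_matrix :: "('i::finite \<Rightarrow> 'i \<Rightarrow> real) \<Rightarrow> bool" where
  "stochastic_matrix p \<longleftrightarrow> (\<forall>i j. 0 \<le> p i j) \<and> (\<forall>i. (\<Sum>j\<in>UNIV. p i j) = 1)"

definition irreducible_tm :: "('i::finite \<Rightarrow> 'i \<Rightarrow> real) \<Rightarrow> bool" where
  "irreducible_tm p \<longleftrightarrow> (\<forall>i j. \<exists>l. mstep p l i j > 0)"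

definition aperiodic_tm :: "('i::finite \<Rightarrow> 'i \<Rightarrow> real) \<Rightarrow> bool" where
  "aperiodic_tm p \<longleftrightarrow> (\<forall>i. Gcd {l::nat. 0 < l \<and> mstep p l i i > 0} = 1)"

definition invariant_dist :: "('i::finite \<Rightarrow> 'i \<Rightarrow> real) \<Rightarrow> ('i \<Rightarrow> real) \<Rightarrow> bool" where
  "invariant_dist p \<pi> \<longleftrightarrow> (\<forall>i. 0 \<le> \<pi> i) \<and> (\<Sum>i\<in>UNIV. \<pi> i) = 1
      \<and> (\<forall>j. (\<Sum>i\<in>UNIV. \<pi> i * p i j) = \<pi> j)"

text \<open>r is a discrete-time Markov chain on M with deterministic initial mode r0 and
  transition probabilities p (the finite-dimensional distributions are determined).\<close>
definition markov_chain :: "'w measure \<Rightarrow> (nat \<Rightarrow> 'w \<Rightarrow> 'i::finite) \<Rightarrow> 'i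
      \<Rightarrow> ('i \<Rightarrow> 'i \<Rightarrow> real) \<Rightarrow> bool" where
  "markov_chain M r r0 p \<longleftrightarrow>
     (\<forall>k. r k \<in> measurable M (count_space UNIV)) \<and>
     (\<forall>\<omega>\<in>space M. r 0 \<omega> = r0) \<and>
     (\<forall>k (s::nat \<Rightarrow> 'i).
        measure M {\<omega>\<in>space M. \<forall>t\<le>Suc k. r t \<omega> = s t}
        = measure M {\<omega>\<in>space M. \<forall>t\<le>k. r t \<omega> = s t} * p (s k) (s (Suc k)))"

text \<open>Independence of the mode process r and the inter-observation times (tau_i)_{i>=1}
  (hence of r and the counting process N): the joint law of the two processes factorises.\<close>
definition indep_processes :: "'w measure \<Rightarrow> (nat \<Rightarrow> 'w \<Rightarrow> 'i) \<Rightarrow> (nat \<Rightarrow> 'w \<Rightarrow> nat) \<Rightarrow> bool" where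
  "indep_processes M r tau \<longleftrightarrow>
     (\<lambda>\<omega> k. r k \<omega>) \<in> measurable M (PiM UNIV (\<lambda>_. count_space UNIV)) \<and>
     (\<lambda>\<omega>. \<lambda>i\<in>{1..}. tau i \<omega>) \<in> measurable M (PiM {1..} (\<lambda>_. count_space UNIV)) \<and>
     (\<forall>X\<in>sets (PiM UNIV (\<lambda>_. count_space UNIV)). \<forall>Y\<in>sets (PiM {1..} (\<lambda>_. count_space UNIV)).
        measure M {\<omega>\<in>space M. (\<lambda>k. r k \<omega>) \<in> X \<and> (\<lambda>i\<in>{1..}. tau i \<omega>) \<in> Y}
        = measure M {\<omega>\<in>space M. (\<lambda>k. r k \<omega>) \<in> X} * measure M {\<omega>\<in>space M. (\<lambda>i\<in>{1..}. tau i \<omega>) \<in> Y})"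

definition obs_time :: "(nat \<Rightarrow> 'w \<Rightarrow> nat) \<Rightarrow> nat \<Rightarrow> 'w \<Rightarrow> nat" where
  "obs_time tau i \<omega> = (\<Sum>j\<in>{1..i}. tau j \<omega>)"

definition count_obs :: "(nat \<Rightarrow> 'w \<Rightarrow> nat) \<Rightarrow> nat \<Rightarrow> 'w \<Rightarrow> nat" where
  "count_obs tau k \<omega> = card {i::nat. 1 \<le> i \<and> obs_time tau i \<omega> \<le> k}"

definition sampled_mode :: "(nat \<Rightarrow> 'w \<Rightarrow> 'i) \<Rightarrow> (nat \<Rightarrow> 'w \<Rightarrow> nat) \<Rightarrow> nat \<Rightarrow> 'w \<Rightarrow> 'i" where
  "sampled_mode r tau k \<omega> = r (obs_time tau (count_obs tau k \<omega>) \<omega>) \<omega>"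

primrec closed_loop ::
  "('i \<Rightarrow> real^'n^'n) \<Rightarrow> ('i \<Rightarrow> real^'m^'n) \<Rightarrow> ('i \<Rightarrow> real^'n^'m)
   \<Rightarrow> (nat \<Rightarrow> 'w \<Rightarrow> 'i) \<Rightarrow> (nat \<Rightarrow> 'w \<Rightarrow> nat) \<Rightarrow> real^'n \<Rightarrow> nat \<Rightarrow> 'w \<Rightarrow> real^'n" where
  "closed_loop A B K r tau x0 0 \<omega> = x0"
| "closed_loop A B K r tau x0 (Suc k) \<omega> =
     A (r k \<omega>) *v closed_loop A B K r tau x0 k \<omega>
     + B (r k \<omega>) *v (K (sampled_mode r tau k \<omega>) *v closed_loop A B K r tau x0 k \<omega>)"

definition as_stable :: "'w measure \<Rightarrow> (real^'n \<Rightarrow> nat \<Rightarrow> 'w \<Rightarrow> real^'n) \<Rightarrow> bool" where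
  "as_stable M x \<longleftrightarrow>
     (\<forall>\<epsilon>>0. \<forall>\<rho>>0. \<exists>\<delta>>0. \<forall>x0. norm x0 < \<delta> \<longrightarrow>
        measure M {\<omega>\<in>space M. (SUP k. ereal (norm (x x0 k \<omega>))) > ereal \<epsilon>} < \<rho>)"

definition as_asymp_stable :: "'w measure \<Rightarrow> (real^'n \<Rightarrow> nat \<Rightarrow> 'w \<Rightarrow> real^'n) \<Rightarrow> bool" where
  "as_asymp_stable M x \<longleftrightarrow> as_stable M x \<and>
     (\<forall>x0. measure M {\<omega>\<in>space M. (\<lambda>k. norm (x x0 k \<omega>)) \<longlonglongrightarrow> 0} = 1)"

definition pos_def :: "real^'n^'n \<Rightarrow> bool" where
  "pos_def R \<longleftrightarrow> (\<forall>v. v \<noteq> 0 \<longrightarrow> v \<bullet> (R *v v) > 0)"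

definition neg_semidef :: "real^'n^'n \<Rightarrow> bool" where
  "neg_semidef Q \<longleftrightarrow> (\<forall>v. v \<bullet> (Q *v v) \<le> 0)"

end

theory Submission
  imports Defs "HOL-Computational_Algebra.Group_Closure"
begin

text \<open>
  With \<open>V x = x\<^sup>T R\<^sup>-\<^sup>1 x\<close> the matrix inequalities give \<open>V (x (k+1)) \<le> \<zeta> V (x k)\<close>, so everything follows once
  the sums \<open>S k\<close> of the bounded quantities \<open>ln \<zeta>\<close> along the trajectory tend to \<open>-\<infinity>\<close> almost surely.

  The waiting times only have a first moment, so each block between two observations is cut off
  after \<open>m\<close> steps. Observed at the observation instants the mode is a finite Markov chain whose
  harmonic functions are constant by irreducibility and aperiodicity; hence Poisson's equation is
  solvable, and adding its solution \<open>f\<close> as a corrector makes the mean increment of the truncated sums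
  equal to their stationary mean, which is negative for large \<open>m\<close>, whatever the current mode.
  Exponential moments then decay geometrically, and Borel-Cantelli gives linear decay at a rate that
  does not depend on \<open>m\<close>. What was cut off is at most a constant times \<open>\<Sum>(\<tau>\<^sub>i - m)\<^sup>+\<close>; by a maximal inequality
  its averages stay below any \<open>\<epsilon> > 0\<close> outside an event of probability at most \<open>E(\<tau> - m)\<^sup>+ / \<epsilon>\<close>, and this
  tends to \<open>0\<close> as \<open>m\<close> grows.
\<close>

text \<open>The chain starts from a fixed mode, the blocks have random lengths, and the gain used
  inside a block depends on the mode at its start. Freezing the waiting times makes the observation
  instants deterministic, so the Markov property at fixed times suffices; averaging over the waiting
  times afterwards uses that the next one is independent of the past.

  Aperiodicity guards against waiting times with a common divisor, for instance a constant period: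
  watched only at multiples of \<open>n\<close>, an irreducible periodic chain could split into
  several classes and have nonconstant harmonic functions.

  Budget of constants: of the corrected drift \<open>- \<eta>\<close> per block, half is given to
  the quadratic error of the exponential and a quarter to the Borel-Cantelli threshold, so truncated
  sums fall at rate \<open>\<eta> / 4\<close>; the steps cut off may consume
  \<open>\<eta> / 8\<close>, and \<open>\<eta> / 8\<close> remains. Since \<open>\<eta>\<close> is
  fixed before the cut-off, the exceptional probability can be sent to 0 within this budget.

  Divergence to minus infinity gives both halves of the claim: convergence directly, and stability
  because such a sequence is bounded above.\<close>

lemma exp_le_quadratic:
  fixes x :: real
  assumes "\<bar>x\<bar> \<le> 1"
  shows "exp x \<le> 1 + x + x\<^sup>2"
proof (cases "0 \<le> x")
  case True
  then show ?thesis using exp_bound[of x] assms by simp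
next
  case False
  have "(1 - x + x\<^sup>2/2) \<le> exp (- x)"
    using exp_lower_Taylor_quadratic[of "-x"] False by simp
  \<comment> \<open>For negative \<open>x\<close> the bound is inverted: \<open>exp (- x)\<close>
    dominates its quadratic Taylor polynomial, so this polynomial inequality remains.\<close>
  moreover have "1 \<le> (1 + x + x\<^sup>2) * (1 - x + x\<^sup>2/2)"
  proof -
    have "(1 + x + x\<^sup>2) * (1 - x + x\<^sup>2/2) = 1 + x\<^sup>2/2 * (1 - x + x\<^sup>2)"
      by (simp add: field_simps power2_eq_square)
    moreover have "0 \<le> x\<^sup>2/2 * (1 - x + x\<^sup>2)" using False by simp
    ultimately show ?thesis by simp
  qed
  moreover have pos: "0 < 1 + x + x\<^sup>2"
  proof -
    have "0 \<le> (x + 1/2)\<^sup>2" by simp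
    then show ?thesis by (simp add: power2_eq_square algebra_simps)
  qed
  ultimately have "1 \<le> (1 + x + x\<^sup>2) * exp (- x)"
    by (meson less_imp_le mult_left_mono order_trans)
  then have "exp x * 1 \<le> exp x * ((1 + x + x\<^sup>2) * exp (- x))"
    by (intro mult_left_mono) auto
  also have "\<dots> = 1 + x + x\<^sup>2" by (simp add: exp_minus)
  finally show ?thesis by simp
qed

section \<open>Stochastic matrices\<close>

lemma mstep_add: "mstep p (a + b) i j = (\<Sum>k\<in>UNIV. mstep p a i k * mstep p b k j)"
proof (induction b arbitrary: j)
  case 0
  then show ?case by (simp add: if_distrib[of "\<lambda>x. _ * x"] cong: if_cong)
next
  case (Suc b)
  have "mstep p (a + Suc b) i j = (\<Sum>l\<in>UNIV. \<Sum>k\<in>UNIV. mstep p a i k * mstep p b k l * p l j)"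
    by (simp add: Suc sum_distrib_right)
  also have "\<dots> = (\<Sum>k\<in>UNIV. \<Sum>l\<in>UNIV. mstep p a i k * mstep p b k l * p l j)"
    by (rule sum.swap)
  finally show ?case by (simp add: sum_distrib_left mult.assoc)
qed

text \<open>The transition operator acting on functions: the mean of \<open>f\<close> after
  \<open>l\<close> steps from \<open>i\<close>.\<close>

definition mop :: "('i::finite \<Rightarrow> 'i \<Rightarrow> real) \<Rightarrow> nat \<Rightarrow> ('i \<Rightarrow> real) \<Rightarrow> 'i \<Rightarrow> real" where
  "mop p l f i = (\<Sum>j\<in>UNIV. mstep p l i j * f j)"

lemma mop_0 [simp]: "mop p 0 f = f"
  by (rule ext) (simp add: mop_def if_distrib[of "\<lambda>x. x * _"] cong: if_cong)

text \<open>The last step is absorbed into the function, the form in which an induction on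
  \<open>l\<close> meets the one-step Markov property.\<close>

lemma mop_Suc: "mop p (Suc l) f i = mop p l (\<lambda>k. \<Sum>j\<in>UNIV. p k j * f j) i"
proof -
  have "mop p (Suc l) f i = (\<Sum>j\<in>UNIV. \<Sum>k\<in>UNIV. mstep p l i k * (p k j * f j))"
    by (simp add: mop_def sum_distrib_right mult.assoc)
  also have "\<dots> = (\<Sum>k\<in>UNIV. \<Sum>j\<in>UNIV. mstep p l i k * (p k j * f j))"
    by (rule sum.swap)
  finally show ?thesis by (simp add: mop_def sum_distrib_left)
qed

lemma mop_add_fun: "mop p l (\<lambda>j. f j + g j) i = mop p l f i + mop p l g i"
  by (simp add: mop_def algebra_simps sum.distrib)

lemma mop_scale: "mop p l (\<lambda>j. c * f j) i = c * mop p l f i"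
  by (simp add: mop_def sum_distrib_left mult.left_commute)

lemma mstep_nonneg: "stochastic_matrix p \<Longrightarrow> 0 \<le> mstep p l i j"
  by (induction l arbitrary: j) (auto simp: stochastic_matrix_def intro!: sum_nonneg)

lemma mop_const: "stochastic_matrix p \<Longrightarrow> mop p l (\<lambda>_. c) i = c"
proof (induction l)
  case (Suc l)
  then have "(\<lambda>k. \<Sum>j\<in>UNIV. p k j * c) = (\<lambda>_. c)"
    by (simp add: stochastic_matrix_def flip: sum_distrib_right)
  then show ?case using Suc by (simp add: mop_Suc)
qed simp

lemma mop_mono:
  assumes "stochastic_matrix p" "\<And>j. f j \<le> g j"
  shows "mop p l f i \<le> mop p l g i"
  unfolding mop_def using mstep_nonneg[OF assms(1)] assms(2)
  by (intro sum_mono mult_left_mono) auto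

lemma abs_mop_le:
  assumes "stochastic_matrix p" "\<And>j. \<bar>f j\<bar> \<le> c"
  shows "\<bar>mop p l f i\<bar> \<le> c"
proof -
  have "mop p l f i \<le> mop p l (\<lambda>_. c) i" "mop p l (\<lambda>_. -c) i \<le> mop p l f i"
    using assms(2) by (intro mop_mono[OF assms(1)]; simp add: abs_le_iff minus_le_iff)+
  then show ?thesis by (simp add: mop_const[OF assms(1)])
qed

lemma abs_le_sum_abs: "\<bar>f y\<bar> \<le> (\<Sum>j\<in>UNIV. \<bar>f j\<bar>)" for f :: "'i::finite \<Rightarrow> real"
  by (rule member_le_sum) auto

lemma invariant_mop:
  assumes "invariant_dist p \<pi>"
  shows "(\<Sum>i\<in>UNIV. \<pi> i * mop p l f i) = (\<Sum>i\<in>UNIV. \<pi> i * f i)"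
proof (induction l arbitrary: f)
  case (Suc l)
  have "(\<Sum>i\<in>UNIV. \<pi> i * mop p (Suc l) f i) = (\<Sum>k\<in>UNIV. \<Sum>j\<in>UNIV. \<pi> k * p k j * f j)"
    by (simp add: mop_Suc Suc sum_distrib_left mult.assoc)
  also have "\<dots> = (\<Sum>j\<in>UNIV. \<Sum>k\<in>UNIV. \<pi> k * p k j * f j)" by (rule sum.swap)
  also have "\<dots> = (\<Sum>j\<in>UNIV. \<pi> j * f j)"
    using assms by (simp add: invariant_dist_def flip: sum_distrib_right)
  finally show ?case .
qed simp

lemma mstep_pos_trans:
  assumes "stochastic_matrix p" "0 < mstep p a i k" "0 < mstep p b k j"
  shows "0 < mstep p (a + b) i j"
proof -
  have "0 < mstep p a i k * mstep p b k j" using assms by simp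
  also have "\<dots> \<le> mstep p (a + b) i j"
    unfolding mstep_add using mstep_nonneg[OF assms(1)] by (intro member_le_sum) auto
  finally show ?thesis .
qed

text \<open>Modulo \<open>n\<close>, negation is multiplication by \<open>n - 1\<close>, so the return times of a state form a
  subgroup of the residues; aperiodicity makes it the whole group.\<close>

lemma aperiodic_return_residue:
  assumes p: "stochastic_matrix p" and ap: "aperiodic_tm p" and n: "0 < n"
  shows "\<exists>d. 0 < mstep p d i i \<and> int n dvd (int d - a)"
proof -
  define D where "D = {d. 0 < mstep p d i i}"
  define H where "H = {x::int. \<exists>d\<in>D. int n dvd (int d - x)}"
  have D0: "0 \<in> D" by (simp add: D_def)
  have Dadd: "a + b \<in> D" if "a \<in> D" "b \<in> D" for a b
    using that mstep_pos_trans[OF p] by (auto simp: D_def)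
  have Dmult: "k * a \<in> D" if "a \<in> D" for k a
    by (induction k) (auto simp: D0 Dadd that)
  have Hdiff: "x - y \<in> H" if xy: "x \<in> H" "y \<in> H" for x y
  proof -
    obtain a b where ab: "a \<in> D" "b \<in> D" "int n dvd (int a - x)" "int n dvd (int b - y)"
      using xy by (auto simp: H_def)
    have eq: "int (a + (n - 1) * b) - (x - y) = (int a - x) - (int b - y) + int n * int b"
      using n by (cases n) (simp_all add: algebra_simps)
    have "int n dvd (int (a + (n - 1) * b) - (x - y))"
      unfolding eq using dvd_add[OF dvd_diff[OF ab(3,4)] dvd_triv_left] .
    moreover have "a + (n - 1) * b \<in> D" using ab by (intro Dadd Dmult)
    ultimately show ?thesis unfolding H_def by blast
  qed
  define S where "S = int ` {l. 0 < l \<and> 0 < mstep p l i i}"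
  have "group_closure S \<subseteq> H"
  proof
    fix s assume "s \<in> group_closure S"
    then show "s \<in> H"
    proof induction
      case (base s)
      then show ?case using D0 by (force simp: S_def H_def D_def)
    next
      case (diff s t)
      then show ?case using Hdiff by blast
    qed
  qed
  moreover have "Gcd S = 1"
    using ap unfolding S_def aperiodic_tm_def by (simp add: Gcd_int_eq)
  \<comment> \<open>A subgroup of the integers generated by a set consists of the multiples of the
    gcd of that set, which is 1 here.\<close>
  ultimately have "a \<in> H"
    using group_closure_eq[of S] by auto
  then show ?thesis by (auto simp: H_def D_def)
qed

text \<open>A path from \<open>x\<close> to \<open>y\<close> of length \<open>a\<close> is prolonged
  by a return to \<open>y\<close> whose length is congruent to \<open>- a\<close> modulo
  \<open>n\<close>. Thus the chain watched every \<open>n\<close> steps is still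
  irreducible.\<close>

lemma multiple_step_pos:
  assumes p: "stochastic_matrix p" and "irreducible_tm p" and "aperiodic_tm p" and n: "0 < n"
  shows "\<exists>k. 0 < mstep p (k * n) x y"
proof -
  obtain a where a: "0 < mstep p a x y" using assms(2) by (auto simp: irreducible_tm_def)
  obtain d where d: "0 < mstep p d y y" "int n dvd (int d - (- int a))"
    using aperiodic_return_residue[OF p assms(3) n] by blast
  then have "int n dvd int (a + d)" by (simp add: add.commute)
  then have "n dvd a + d" by (simp only: int_dvd_int_iff)
  then obtain k where "a + d = k * n" by (metis dvd_def mult.commute)
  then show ?thesis using mstep_pos_trans[OF p a d(1)] by metis
qed

text \<open>Maximum principle: a weighted mean equal to the maximum \<open>c\<close> forces the
  value \<open>c\<close> at every state carrying weight. Iterating steps of length \<open>n\<close>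
  reaches all states by the preceding lemma.\<close>

lemma argmax_spreads:
  assumes p: "stochastic_matrix p" and "irreducible_tm p" and "aperiodic_tm p" and n: "0 < n"
    and le: "\<And>x. f x \<le> c" and x0: "f x0 = c" and cl: "\<And>x. f x = c \<Longrightarrow> mop p n f x = c"
  shows "f y = c"
proof -
  have step: "f z = c" if "f x = c" "0 < mstep p n x z" for x z
  proof -
    have "(\<Sum>j\<in>UNIV. mstep p n x j * (c - f j)) = mop p n (\<lambda>_. c) x - mop p n f x"
      by (simp add: mop_def algebra_simps sum_subtractf)
    also have "\<dots> = 0" using cl[OF that(1)] mop_const[OF p] by simp
    finally have "mstep p n x z * (c - f z) = 0"
      using mstep_nonneg[OF p] le by (subst (asm) sum_nonneg_eq_0_iff) auto
    then show ?thesis using that(2) by simp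
  qed
  have "f z = c" if "0 < mstep p (k * n) x0 z" for k z
    using that
  proof (induction k arbitrary: z)
    case 0
    then show ?case using x0 by (auto split: if_splits)
  next
    case (Suc k)
    have "0 < (\<Sum>l\<in>UNIV. mstep p (k * n) x0 l * mstep p n l z)"
      using Suc.prems by (simp add: add.commute[of n] mstep_add)
    then obtain l where "mstep p (k * n) x0 l * mstep p n l z > 0"
      by (meson not_le sum_nonpos)
    then have "0 < mstep p (k * n) x0 l" "0 < mstep p n l z"
      using mstep_nonneg[OF p] by (auto simp: zero_less_mult_iff dest: leD)
    then show ?case using Suc.IH step by blast
  qed
  then show ?thesis using multiple_step_pos[OF assms(1-4)] by blast
qed

section \<open>The quadratic Lyapunov function\<close>

lemma pos_def_invertible: "pos_def R \<Longrightarrow> invertible R"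
  by (metis pos_def_def inner_zero_right invertible_left_inverse less_irrefl matrix_left_invertible_ker)

lemma pos_def_matrix_inv:
  fixes R :: "real^'n^'n"
  assumes "pos_def R"
  shows "R ** matrix_inv R = mat 1" "matrix_inv R ** R = mat 1"
    "pos_def (matrix_inv R)"
proof -
  show R1: "R ** matrix_inv R = mat 1" "matrix_inv R ** R = mat 1"
    using pos_def_invertible[OF assms]
    unfolding matrix_inv_def invertible_def by (metis (mono_tags, lifting) someI_ex)+
  show "pos_def (matrix_inv R)" unfolding pos_def_def
  proof (intro allI impI)
    fix v :: "real^'n" assume v: "v \<noteq> 0"
    let ?w = "matrix_inv R *v v"
    have w: "R *v ?w = v" by (simp add: matrix_vector_mul_assoc R1)
    then have "?w \<noteq> 0" using v by (metis matrix_vector_mult_0_right)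
    then have "0 < ?w \<bullet> (R *v ?w)" using assms by (simp add: pos_def_def)
    then show "0 < v \<bullet> (matrix_inv R *v v)" by (simp only: w inner_commute)
  qed
qed

text \<open>The constants are the extrema of the quadratic form on the compact unit sphere;
  homogeneity of degree 2 carries them to all vectors.\<close>

lemma pos_def_bounds:
  fixes P :: "real^'n^'n"
  assumes "pos_def P"
  obtains a b where "0 < a" "0 < b" "\<And>x. a * (norm x)\<^sup>2 \<le> x \<bullet> (P *v x)" "\<And>x. x \<bullet> (P *v x) \<le> b * (norm x)\<^sup>2"
proof -
  let ?q = "\<lambda>x::real^'n. x \<bullet> (P *v x)"
  have cont: "continuous_on (sphere 0 1) ?q"
    by (intro continuous_intros linear_continuous_on matrix_vector_mul_bounded_linear)
  have "sphere (0::real^'n) 1 \<noteq> {}" by simp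
  then obtain u where u: "u \<in> sphere 0 1" "\<And>y. y \<in> sphere 0 1 \<Longrightarrow> ?q u \<le> ?q y"
    using continuous_attains_inf[OF compact_sphere _ cont] by blast
  obtain w where w: "w \<in> sphere 0 1" "\<And>y. y \<in> sphere 0 1 \<Longrightarrow> ?q y \<le> ?q w"
    using continuous_attains_sup[OF compact_sphere _ cont] \<open>sphere (0::real^'n) 1 \<noteq> {}\<close> by blast
  have pos: "0 < ?q y" if "y \<in> sphere 0 1" for y
  proof -
    have "y \<noteq> 0" using that by auto
    then show ?thesis using assms by (simp add: pos_def_def)
  qed
  have scale: "?q x = ?q (x /\<^sub>R norm x) * (norm x)\<^sup>2" if "x \<noteq> 0" for x
    using that by (simp add: matrix_vector_mult_scaleR power2_eq_square field_simps)
  have sph: "x /\<^sub>R norm x \<in> sphere 0 1" if "x \<noteq> 0" for x :: "real^'n"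
    using that by simp
  show ?thesis
  proof
    show "0 < ?q u" "0 < ?q w" using pos u w by auto
    fix x
    show "?q u * (norm x)\<^sup>2 \<le> ?q x"
      using u(2)[OF sph[of x]] scale[of x]
      by (cases "x = 0") (auto simp del: inner_scaleR_left intro: mult_right_mono)
    show "?q x \<le> ?q w * (norm x)\<^sup>2"
      using w(2)[OF sph[of x]] scale[of x]
      by (cases "x = 0") (auto simp del: inner_scaleR_left intro: mult_right_mono)
  qed
qed

text \<open>The matrix inequality is tested at the vector \<open>matrix_inv R *v x\<close>. There
  \<open>A ** R + B ** L\<close> yields the closed-loop successor of \<open>x\<close> under the gain
  \<open>L ** matrix_inv R\<close>, and the subtracted term becomes \<open>z\<close> times
  \<open>V x\<close>.\<close>

lemma lyapunov_step:
  fixes R :: "real^'n^'n" and A :: "real^'n^'n" and B :: "real^'m^'n" and L :: "real^'n^'m"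
  assumes R: "pos_def R"
    and neg: "neg_semidef (transpose (A ** R + B ** L) ** matrix_inv R ** (A ** R + B ** L) - z *\<^sub>R R)"
  defines "V \<equiv> \<lambda>x. x \<bullet> (matrix_inv R *v x)"
  shows "V (A *v x + B *v ((L ** matrix_inv R) *v x)) \<le> z * V x"
proof -
  note inv = pos_def_matrix_inv[OF R]
  define C where "C = A ** R + B ** L"
  define v where "v = matrix_inv R *v x"
  have Rv: "R *v v = x" by (simp add: v_def matrix_vector_mul_assoc inv)
  have Cv: "C *v v = A *v x + B *v ((L ** matrix_inv R) *v x)"
    by (simp add: C_def matrix_vector_mult_add_rdistrib Rv v_def flip: matrix_vector_mul_assoc)
       (simp add: matrix_vector_mul_assoc inv matrix_mul_assoc Rv[unfolded v_def])
  have "0 \<ge> v \<bullet> ((transpose C ** matrix_inv R ** C - z *\<^sub>R R) *v v)"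
    using neg by (simp add: neg_semidef_def C_def)
  also have "v \<bullet> ((transpose C ** matrix_inv R ** C - z *\<^sub>R R) *v v)
      = v \<bullet> (transpose C *v (matrix_inv R *v (C *v v))) - z * (v \<bullet> (R *v v))"
    by (simp add: matrix_vector_mult_diff_rdistrib inner_diff_right scaleR_matrix_vector_assoc[symmetric]
        matrix_vector_mul_assoc matrix_mul_assoc)
  also have "v \<bullet> (transpose C *v (matrix_inv R *v (C *v v))) = V (C *v v)"
    unfolding V_def transpose_matrix_vector
    by (simp only: inner_commute[of v] dot_lmul_matrix inner_commute[of "matrix_inv R *v _"])
  finally have "V (C *v v) \<le> z * (v \<bullet> x)" by (simp add: Rv)
  moreover have "v \<bullet> x = V x" by (simp add: V_def v_def inner_commute)
  ultimately show ?thesis by (simp add: Cv)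
qed

section \<open>The sampled chain\<close>

abbreviation seq_space :: "(nat \<Rightarrow> 'a) measure" where
  "seq_space \<equiv> PiM UNIV (\<lambda>_. count_space UNIV)"

locale sampled_chain = prob_space M for M :: "'w measure" +
  fixes r :: "nat \<Rightarrow> 'w \<Rightarrow> 'i::finite" and r0 :: 'i and p :: "'i \<Rightarrow> 'i \<Rightarrow> real"
    and \<pi> :: "'i \<Rightarrow> real" and tau :: "nat \<Rightarrow> 'w \<Rightarrow> nat" and mu :: "nat \<Rightarrow> real"
  assumes stoch: "stochastic_matrix p"
    and chain: "markov_chain M r r0 p"
    and irred: "irreducible_tm p" and aper: "aperiodic_tm p"
    and invar: "invariant_dist p \<pi>"
    and tau_indep: "indep_vars (\<lambda>_. count_space UNIV) tau {1..}"
    and tau_law: "\<And>i t. 1 \<le> i \<Longrightarrow> measure M {\<omega>\<in>space M. tau i \<omega> = t} = mu t"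
    and mu_0: "mu 0 = 0"
    and mu_mean: "summable (\<lambda>t. real t * mu t)"
    and r_tau_indep: "indep_processes M r tau"
begin

text \<open>The shift drops \<open>tau 0\<close>, which is unconstrained and need not even be measurable.\<close>

definition wait :: "'w \<Rightarrow> nat \<Rightarrow> nat" where
  "wait \<omega> i = tau (Suc i) \<omega>"

definition mode :: "'w \<Rightarrow> nat \<Rightarrow> 'i" where
  "mode \<omega> k = r k \<omega>"

lemma mode_measurable_component [measurable]: "(\<lambda>\<omega>. mode \<omega> k) \<in> measurable M (count_space UNIV)"
  using chain by (simp add: mode_def markov_chain_def)

lemma wait_measurable_component [measurable]: "(\<lambda>\<omega>. wait \<omega> k) \<in> measurable M (count_space UNIV)"
  using tau_indep by (auto simp: wait_def indep_vars_def)

lemma mode_measurable [measurable]: "mode \<in> measurable M seq_space"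
  by (rule measurable_PiM_single') (auto simp: space_PiM)

lemma wait_measurable [measurable]: "wait \<in> measurable M seq_space"
  by (rule measurable_PiM_single') (auto simp: space_PiM)

lemma shifted_wait_indep: "indep_vars (\<lambda>_. count_space UNIV) (\<lambda>i \<omega>. wait \<omega> (i + a)) UNIV"
proof -
  \<comment> \<open>Reindexing is done by grouping the original family along disjoint singletons and
    projecting each group to its only coordinate.\<close>
  have "indep_vars (\<lambda>j. PiM {Suc (j + a)} (\<lambda>_. count_space UNIV))
      (\<lambda>j \<omega>. restrict (\<lambda>i. tau i \<omega>) {Suc (j + a)}) UNIV"
    by (rule indep_vars_restrict[OF tau_indep]) (auto simp: disjoint_family_on_def)
  then have "indep_vars (\<lambda>_. count_space UNIV)
      (\<lambda>j \<omega>. (\<lambda>v. v (Suc (j + a))) (restrict (\<lambda>i. tau i \<omega>) {Suc (j + a)})) UNIV"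
    by (rule indep_vars_compose2) simp
  then show ?thesis by (simp add: wait_def)
qed

lemma wait_distr: "distr M (count_space UNIV) (\<lambda>\<omega>. wait \<omega> i) = distr M (count_space UNIV) (\<lambda>\<omega>. wait \<omega> 0)"
proof (rule measure_eqI_countable[of _ UNIV])
  have ev: "{\<omega> \<in> space M. wait \<omega> i = t} = (\<lambda>\<omega>. wait \<omega> i) -` {t} \<inter> space M" for i t by auto
  show "emeasure (distr M (count_space UNIV) (\<lambda>\<omega>. wait \<omega> i)) {t}
      = emeasure (distr M (count_space UNIV) (\<lambda>\<omega>. wait \<omega> 0)) {t}" for t
  proof -
    have "prob {\<omega> \<in> space M. wait \<omega> i = t} = prob {\<omega> \<in> space M. wait \<omega> 0 = t}"
      using tau_law[of "Suc i" t] tau_law[of 1 t] by (simp add: wait_def)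
    then show ?thesis by (simp add: emeasure_distr emeasure_eq_measure ev)
  qed
qed auto

text \<open>Independence makes both laws products, and all marginals agree. This shift invariance
  drives the maximal inequality.\<close>

lemma shifted_wait_distr:
  "distr M seq_space (\<lambda>\<omega> i. wait \<omega> (i + a)) = distr M seq_space wait"
proof -
  have "distr M seq_space (\<lambda>\<omega> i. wait \<omega> (i + a))
      = PiM UNIV (\<lambda>_. distr M (count_space UNIV) (\<lambda>\<omega>. wait \<omega> 0))" for a
    using indep_vars_iff_distr_eq_PiM[THEN iffD1, OF _ _ shifted_wait_indep[of a]]
    by (simp add: wait_distr[of "_ + a"] restrict_def)
  from this[of a] this[of 0] show ?thesis by simp
qed

lemma mode_wait_distr:
  "distr M (seq_space \<Otimes>\<^sub>M seq_space) (\<lambda>\<omega>. (mode \<omega>, wait \<omega>))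
    = distr M seq_space mode \<Otimes>\<^sub>M distr M seq_space wait"
proof (rule pair_measure_eqI[symmetric])
  show "sigma_finite_measure (distr M seq_space mode)" "sigma_finite_measure (distr M seq_space wait)"
    by (intro prob_space_imp_sigma_finite prob_space_distr; measurable)+
  show "sets (distr M seq_space mode \<Otimes>\<^sub>M distr M seq_space wait)
      = sets (distr M (seq_space \<Otimes>\<^sub>M seq_space) (\<lambda>\<omega>. (mode \<omega>, wait \<omega>)))"
    by (simp cong: sets_pair_measure_cong)
  fix A B assume "A \<in> sets (distr M seq_space mode)" "B \<in> sets (distr M seq_space wait)"
  then have A [measurable]: "A \<in> sets seq_space" and B [measurable]: "B \<in> sets seq_space" by auto
  \<comment> \<open>The independence hypothesis indexes the waiting times from 1.
    \<open>\<theta>\<close> renumbers from 0, and \<open>B'\<close> is the event \<open>B\<close>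
    pulled back to the original indexing.\<close>
  define \<theta> :: "(nat \<Rightarrow> nat) \<Rightarrow> nat \<Rightarrow> nat" where "\<theta> v i = v (Suc i)" for v i
  have \<theta> [measurable]: "\<theta> \<in> measurable (PiM {1..} (\<lambda>_. count_space UNIV)) seq_space"
    by (rule measurable_PiM_single') (auto simp: space_PiM \<theta>_def)
  define B' where "B' = \<theta> -` B \<inter> space (PiM {1..} (\<lambda>_. count_space UNIV))"
  have B': "B' \<in> sets (PiM {1..} (\<lambda>_. count_space UNIV))" unfolding B'_def by measurable
  have B'_iff: "(\<lambda>i\<in>{1..}. tau i \<omega>) \<in> B' \<longleftrightarrow> wait \<omega> \<in> B" for \<omega>
  proof -
    have "\<theta> (\<lambda>i\<in>{1..}. tau i \<omega>) = wait \<omega>" by (auto simp: \<theta>_def wait_def)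
    then show ?thesis by (auto simp: B'_def space_PiM)
  qed
  have "measure M {\<omega>\<in>space M. mode \<omega> \<in> A \<and> wait \<omega> \<in> B}
      = measure M {\<omega>\<in>space M. mode \<omega> \<in> A} * measure M {\<omega>\<in>space M. wait \<omega> \<in> B}"
    using r_tau_indep A B' unfolding indep_processes_def B'_iff[symmetric] mode_def[abs_def] by blast
  moreover have "mode -` A \<inter> space M = {\<omega>\<in>space M. mode \<omega> \<in> A}"
    "wait -` B \<inter> space M = {\<omega>\<in>space M. wait \<omega> \<in> B}"
    "(\<lambda>\<omega>. (mode \<omega>, wait \<omega>)) -` (A \<times> B) \<inter> space M = {\<omega>\<in>space M. mode \<omega> \<in> A \<and> wait \<omega> \<in> B}"
    by auto
  ultimately show "emeasure (distr M seq_space mode) A * emeasure (distr M seq_space wait) B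
      = emeasure (distr M (seq_space \<Otimes>\<^sub>M seq_space) (\<lambda>\<omega>. (mode \<omega>, wait \<omega>))) (A \<times> B)"
    by (simp add: emeasure_distr emeasure_eq_measure ennreal_mult)
qed

text \<open>Fubini for the product law: the waiting times are frozen at \<open>\<omega>\<close>
  while the modes are averaged over a second sample point \<open>\<omega>'\<close>, which acts as an
  independent copy.\<close>

lemma expectation_mode_wait:
  fixes F :: "(nat \<Rightarrow> nat) \<Rightarrow> (nat \<Rightarrow> 'i) \<Rightarrow> real"
  assumes F [measurable]: "(\<lambda>(\<rho>, u). F u \<rho>) \<in> borel_measurable (seq_space \<Otimes>\<^sub>M seq_space)"
    and bd: "\<And>u \<rho>. \<bar>F u \<rho>\<bar> \<le> c"
  shows "expectation (\<lambda>\<omega>. F (wait \<omega>) (mode \<omega>)) = expectation (\<lambda>\<omega>. expectation (\<lambda>\<omega>'. F (wait \<omega>) (mode \<omega>')))"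
    and "(\<lambda>u. expectation (\<lambda>\<omega>. F u (mode \<omega>))) \<in> borel_measurable seq_space"
proof -
  let ?R = "distr M seq_space mode" and ?W = "distr M seq_space wait"
  interpret R: prob_space ?R by (rule prob_space_distr) measurable
  interpret W: prob_space ?W by (rule prob_space_distr) measurable
  interpret RW: pair_prob_space ?R ?W ..
  have int: "integrable (?R \<Otimes>\<^sub>M ?W) (\<lambda>(\<rho>, u). F u \<rho>)"
    using bd by (intro RW.integrable_const_bound[of _ c]) (auto simp: split_beta')
  have Fu: "F u \<in> borel_measurable seq_space" for u
    using measurable_compose[OF measurable_Pair2'[of u seq_space seq_space] F] by (simp add: space_PiM)
  have inner: "(\<integral>\<rho>. F u \<rho> \<partial>?R) = expectation (\<lambda>\<omega>. F u (mode \<omega>))" for u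
    by (subst integral_distr) (auto simp: Fu)
  have "(\<lambda>u. \<integral>\<rho>. F u \<rho> \<partial>?R) \<in> borel_measurable ?W"
  proof (rule R.borel_measurable_lebesgue_integral)
    have "(\<lambda>(u, \<rho>). F u \<rho>) \<in> borel_measurable (seq_space \<Otimes>\<^sub>M seq_space)"
      using measurable_compose[OF measurable_pair_swap' F] by (simp add: split_beta')
    then show "(\<lambda>(u, \<rho>). F u \<rho>) \<in> borel_measurable (?W \<Otimes>\<^sub>M ?R)"
      by (simp cong: measurable_cong_sets sets_pair_measure_cong)
  qed
  then show meas: "(\<lambda>u. expectation (\<lambda>\<omega>. F u (mode \<omega>))) \<in> borel_measurable seq_space"
    by (simp add: inner)
  have "expectation (\<lambda>\<omega>. F (wait \<omega>) (mode \<omega>))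
      = (\<integral>x. (\<lambda>(\<rho>, u). F u \<rho>) x \<partial>distr M (seq_space \<Otimes>\<^sub>M seq_space) (\<lambda>\<omega>. (mode \<omega>, wait \<omega>)))"
    by (subst integral_distr) auto
  also have "\<dots> = (\<integral>u. (\<integral>\<rho>. F u \<rho> \<partial>?R) \<partial>?W)"
    unfolding mode_wait_distr by (rule RW.integral_snd[symmetric, OF int])
  also have "\<dots> = expectation (\<lambda>\<omega>. expectation (\<lambda>\<omega>'. F (wait \<omega>) (mode \<omega>')))"
    unfolding inner by (subst integral_distr) (auto simp: meas)
  finally show "expectation (\<lambda>\<omega>. F (wait \<omega>) (mode \<omega>)) = expectation (\<lambda>\<omega>. expectation (\<lambda>\<omega>'. F (wait \<omega>) (mode \<omega>')))" .
qed

section \<open>The Markov property for functions of finitely many modes\<close>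

definition path_event :: "nat \<Rightarrow> (nat \<Rightarrow> 'i) \<Rightarrow> 'w set" where
  "path_event k s = {\<omega>\<in>space M. \<forall>t\<le>k. mode \<omega> t = s t}"

lemma path_event_sets [measurable]: "path_event k s \<in> sets M"
  unfolding path_event_def by measurable

lemma prob_path_event_Suc:
  "prob (path_event (Suc k) s) = prob (path_event k s) * p (s k) (s (Suc k))"
  using chain by (simp add: markov_chain_def path_event_def mode_def)

text \<open>Adaptedness to the modes up to time \<open>k\<close>, stated as functional dependence.
  As there are finitely many modes, such a function is a finite combination of indicators of
  cylinder events along the trajectory, so it is integrable without any further assumption.\<close>

definition determined_by :: "nat \<Rightarrow> ((nat \<Rightarrow> 'i) \<Rightarrow> real) \<Rightarrow> bool" where
  "determined_by k F \<longleftrightarrow> (\<forall>s s'. (\<forall>t\<le>k. s t = s' t) \<longrightarrow> F s = F s')"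

lemma determined_by_mono: "determined_by k F \<Longrightarrow> k \<le> l \<Longrightarrow> determined_by l F"
  by (auto simp: determined_by_def)

lemma determined_sum:
  assumes "determined_by k F" "\<omega> \<in> space M"
  shows "F (mode \<omega>) = (\<Sum>s\<in>PiE {..k} (\<lambda>_. UNIV). F s * indicator (path_event k s) \<omega>)"
proof -
  let ?s = "restrict (mode \<omega>) {..k}"
  have "(\<Sum>s\<in>PiE {..k} (\<lambda>_. UNIV). F s * indicator (path_event k s) \<omega>)
      = (\<Sum>s\<in>PiE {..k} (\<lambda>_. UNIV). if s = ?s then F s else 0)"
  proof (intro sum.cong refl)
    fix s assume "s \<in> PiE {..k} (\<lambda>_. UNIV :: 'i set)"
    then have "\<omega> \<in> path_event k s \<longleftrightarrow> s = ?s"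
      using assms(2) by (auto simp: path_event_def PiE_def extensional_def restrict_def fun_eq_iff)
    then show "F s * indicator (path_event k s) \<omega> = (if s = ?s then F s else 0)" by auto
  qed
  also have "\<dots> = F ?s"
    by (subst sum.delta) (auto simp: finite_PiE)
  also have "\<dots> = F (mode \<omega>)" using assms(1) unfolding determined_by_def by auto
  finally show ?thesis by simp
qed

lemma determined_integrable:
  assumes "determined_by k F"
  shows "integrable M (\<lambda>\<omega>. F (mode \<omega>))"
proof -
  have "integrable M (\<lambda>\<omega>. \<Sum>s\<in>PiE {..k} (\<lambda>_. UNIV). F s * indicator (path_event k s) \<omega>)"
    by (intro Bochner_Integration.integrable_sum integrable_mult_right) (simp add: emeasure_eq_measure)
  then show ?thesis
    by (subst Bochner_Integration.integrable_cong[OF refl determined_sum[OF assms]])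
qed

text \<open>The left side is split along the finitely many cylinder events up to time
  \<open>k + 1\<close>; the product formula of the chain supplies the factor \<open>p\<close> on
  each, and the pieces are reassembled at time \<open>k\<close>.\<close>

lemma markov_step:
  assumes F: "determined_by k F"
  shows "expectation (\<lambda>\<omega>. F (mode \<omega>) * \<phi> (mode \<omega> (Suc k)))
    = expectation (\<lambda>\<omega>. F (mode \<omega>) * (\<Sum>j\<in>UNIV. p (mode \<omega> k) j * \<phi> j))"
proof -
  let ?P = "PiE {..k} (\<lambda>_. UNIV :: 'i set)"
  have fin: "finite ?P" by (simp add: finite_PiE)
  have "expectation (\<lambda>\<omega>. F (mode \<omega>) * \<phi> (mode \<omega> (Suc k)))
      = expectation (\<lambda>\<omega>. \<Sum>s\<in>?P. \<Sum>j\<in>UNIV. F s * \<phi> j * indicator (path_event (Suc k) (s(Suc k := j))) \<omega>)"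
  proof (intro Bochner_Integration.integral_cong refl)
    fix \<omega> assume \<omega>: "\<omega> \<in> space M"
    have "(\<Sum>j\<in>UNIV. F s * \<phi> j * indicator (path_event (Suc k) (s(Suc k := j))) \<omega>)
        = F s * indicator (path_event k s) \<omega> * \<phi> (mode \<omega> (Suc k))" for s
    proof -
      have "(indicator (path_event (Suc k) (s(Suc k := j))) \<omega> :: real)
          = indicator (path_event k s) \<omega> * (if j = mode \<omega> (Suc k) then 1 else 0)" for j
        by (auto simp: path_event_def indicator_def le_Suc_eq)
      then have "(\<Sum>j\<in>UNIV. F s * \<phi> j * indicator (path_event (Suc k) (s(Suc k := j))) \<omega>)
        = (\<Sum>j\<in>UNIV. if j = mode \<omega> (Suc k) then F s * \<phi> j * indicator (path_event k s) \<omega> else 0)"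
        by (intro sum.cong) auto
      then show ?thesis by simp
    qed
    then show "F (mode \<omega>) * \<phi> (mode \<omega> (Suc k))
        = (\<Sum>s\<in>?P. \<Sum>j\<in>UNIV. F s * \<phi> j * indicator (path_event (Suc k) (s(Suc k := j))) \<omega>)"
      by (simp add: determined_sum[OF F \<omega>] sum_distrib_right)
  qed
  also have "\<dots> = (\<Sum>s\<in>?P. \<Sum>j\<in>UNIV. F s * \<phi> j * prob (path_event (Suc k) (s(Suc k := j))))"
    by (simp add: Bochner_Integration.integral_sum Bochner_Integration.integrable_sum emeasure_eq_measure
      del: sum_mult_indicator sum_indicator_mult)
  also have "\<dots> = (\<Sum>s\<in>?P. F s * prob (path_event k s) * (\<Sum>j\<in>UNIV. p (s k) j * \<phi> j))"
  proof (intro sum.cong refl)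
    fix s
    have "path_event k (s(Suc k := j)) = path_event k s" for j
      by (auto simp: path_event_def)
    then show "(\<Sum>j\<in>UNIV. F s * \<phi> j * prob (path_event (Suc k) (s(Suc k := j))))
        = F s * prob (path_event k s) * (\<Sum>j\<in>UNIV. p (s k) j * \<phi> j)"
      by (simp add: prob_path_event_Suc sum_distrib_left mult_ac)
  qed
  also have "\<dots> = expectation (\<lambda>\<omega>. \<Sum>s\<in>?P. F s * indicator (path_event k s) \<omega> * (\<Sum>j\<in>UNIV. p (s k) j * \<phi> j))"
    by (simp add: Bochner_Integration.integral_sum emeasure_eq_measure
      del: sum_mult_indicator sum_indicator_mult)
  also have "\<dots> = expectation (\<lambda>\<omega>. F (mode \<omega>) * (\<Sum>j\<in>UNIV. p (mode \<omega> k) j * \<phi> j))"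
  proof (intro Bochner_Integration.integral_cong refl)
    fix \<omega> assume \<omega>: "\<omega> \<in> space M"
    show "(\<Sum>s\<in>?P. F s * indicator (path_event k s) \<omega> * (\<Sum>j\<in>UNIV. p (s k) j * \<phi> j))
      = F (mode \<omega>) * (\<Sum>j\<in>UNIV. p (mode \<omega> k) j * \<phi> j)"
      unfolding determined_sum[OF F \<omega>] sum_distrib_right[of _ ?P]
      by (intro sum.cong) (auto simp: path_event_def indicator_def)
  qed
  finally show ?thesis .
qed

lemma markov_steps:
  assumes "determined_by k F"
  shows "expectation (\<lambda>\<omega>. F (mode \<omega>) * \<phi> (mode \<omega> (k + l))) = expectation (\<lambda>\<omega>. F (mode \<omega>) * mop p l \<phi> (mode \<omega> k))"
proof (induction l arbitrary: \<phi>)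
  case (Suc l)
  show ?case
    using markov_step[OF determined_by_mono[OF assms, of "k + l"], of \<phi>] Suc
    by (simp add: mop_Suc)
qed simp

text \<open>Here the test function may also depend on the present mode, as the gain does on the mode
  seen at an observation. Splitting by the value \<open>y\<close> of that mode reduces to a fixed
  test function.\<close>

lemma markov_property:
  assumes F: "determined_by k F"
  shows "expectation (\<lambda>\<omega>. F (mode \<omega>) * \<phi> (mode \<omega> k) (mode \<omega> (k + l)))
    = expectation (\<lambda>\<omega>. F (mode \<omega>) * mop p l (\<phi> (mode \<omega> k)) (mode \<omega> k))"
proof -
  define G where "G y s = F s * (if s k = y then 1 else 0)" for y s
  have G: "determined_by k (G y)" for y
    using F by (auto simp: determined_by_def G_def)
  have eq1: "F (mode \<omega>) * \<phi> (mode \<omega> k) (mode \<omega> (k + l)) = (\<Sum>y\<in>UNIV. G y (mode \<omega>) * \<phi> y (mode \<omega> (k + l)))" for \<omega>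
    by (subst sum.remove[of _ "mode \<omega> k"]) (auto simp: G_def intro!: sum.neutral)
  have eq2: "F (mode \<omega>) * mop p l (\<phi> (mode \<omega> k)) (mode \<omega> k) = (\<Sum>y\<in>UNIV. G y (mode \<omega>) * mop p l (\<phi> y) (mode \<omega> k))" for \<omega>
    by (subst sum.remove[of _ "mode \<omega> k"]) (auto simp: G_def intro!: sum.neutral)
  have int1: "integrable M (\<lambda>\<omega>. G y (mode \<omega>) * \<phi> y (mode \<omega> (k + l)))" for y
    by (rule determined_integrable[of "k + l" "\<lambda>s. G y s * \<phi> y (s (k + l))"])
      (use determined_by_mono[OF G, of "k + l"] in \<open>auto simp: determined_by_def\<close>)
  have int2: "integrable M (\<lambda>\<omega>. G y (mode \<omega>) * mop p l (\<phi> y) (mode \<omega> k))" for y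
    by (rule determined_integrable[of k "\<lambda>s. G y s * mop p l (\<phi> y) (s k)"])
      (use G in \<open>auto simp: determined_by_def\<close>)
  show ?thesis unfolding eq1 eq2
    using int1 int2 markov_steps[OF G] by simp
qed

end

lemma measurable_fun2:
  fixes X :: "'a \<Rightarrow> 'b::countable" and Y :: "'a \<Rightarrow> 'c::countable"
  assumes [measurable]: "X \<in> measurable N (count_space UNIV)" "Y \<in> measurable N (count_space UNIV)"
    and "\<And>x y. h x y \<in> space K"
  shows "(\<lambda>a. h (X a) (Y a)) \<in> measurable N K"
proof (rule measurable_compose_countable[where f = "\<lambda>x a. h x (Y a)" and g = X])
  show "(\<lambda>a. h x (Y a)) \<in> measurable N K" for x
    by (rule measurable_compose[where g = "h x" and N = "count_space UNIV"]) (auto simp: assms)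
qed measurable

section \<open>A maximal inequality for the waiting times\<close>

text \<open>The maximum of the partial sums of \<open>W (u i)\<close> of lengths 0 to
  \<open>n\<close>. Recursion at the front makes the maximum of the shifted sequence appear, which
  is what Garsia's argument compares with.\<close>

primrec max_partial_sum :: "(nat \<Rightarrow> real) \<Rightarrow> nat \<Rightarrow> (nat \<Rightarrow> nat) \<Rightarrow> real" where
  "max_partial_sum W 0 u = 0"
| "max_partial_sum W (Suc n) u = max 0 (W (u 0) + max_partial_sum W n (\<lambda>i. u (Suc i)))"

lemma max_partial_sum_nonneg: "0 \<le> max_partial_sum W n u"
  by (cases n) auto

lemma max_partial_sum_mono: "max_partial_sum W n u \<le> max_partial_sum W (Suc n) u"
proof (induction n arbitrary: u)
  case (Suc n)
  show ?case using Suc[of "\<lambda>i. u (Suc i)"] unfolding max_partial_sum.simps by linarith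
qed simp

lemma max_partial_sum_le: "max_partial_sum W n u \<le> (\<Sum>i<n. \<bar>W (u i)\<bar>)"
proof (induction n arbitrary: u)
  case (Suc n)
  have "(\<Sum>i<Suc n. \<bar>W (u i)\<bar>) = \<bar>W (u 0)\<bar> + (\<Sum>i<n. \<bar>W (u (Suc i))\<bar>)"
    by (simp only: sum.lessThan_Suc_shift)
  with Suc[of "\<lambda>i. u (Suc i)"] sum_nonneg[of "{..<n}" "\<lambda>i. \<bar>W (u (Suc i))\<bar>"]
  show ?case unfolding max_partial_sum.simps by linarith
qed simp

lemma sum_le_max_partial_sum: "k \<le> n \<Longrightarrow> (\<Sum>i<k. W (u i)) \<le> max_partial_sum W n u"
proof (induction n arbitrary: u k)
  case (Suc n)
  show ?case
  proof (cases k)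
    case (Suc k')
    then have "(\<Sum>i<k. W (u i)) = W (u 0) + (\<Sum>i<k'. W (u (Suc i)))"
      by (simp only: sum.lessThan_Suc_shift)
    with Suc.IH[of k' "\<lambda>i. u (Suc i)"] Suc.prems Suc show ?thesis by simp
  qed (simp add: max_partial_sum_nonneg)
qed simp

lemma max_partial_sum_measurable [measurable]: "max_partial_sum W n \<in> borel_measurable seq_space"
proof (induction n)
  case (Suc n)
  have sh [measurable]: "(\<lambda>u i. u (Suc i)) \<in> measurable seq_space (seq_space :: (nat \<Rightarrow> nat) measure)"
    by (rule measurable_PiM_single') (auto simp: space_PiM)
  have [measurable]: "(\<lambda>u. W (u 0)) \<in> borel_measurable seq_space"
    by (rule measurable_compose[where N = "count_space UNIV"]) auto
  have [measurable]: "(\<lambda>u. max_partial_sum W n (\<lambda>i. u (Suc i))) \<in> borel_measurable seq_space"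
    by (rule measurable_compose[OF sh Suc])
  show ?case by simp
qed simp

context sampled_chain
begin

lemma wait_fun_measurable [measurable]: "(\<lambda>\<omega>. \<phi> (wait \<omega> i)) \<in> borel_measurable M"
  for \<phi> :: "nat \<Rightarrow> real"
  by (rule measurable_compose[OF wait_measurable_component]) auto

lemma expectation_wait: "expectation (\<lambda>\<omega>. \<phi> (wait \<omega> i)) = expectation (\<lambda>\<omega>. \<phi> (wait \<omega> 0))"
  for \<phi> :: "nat \<Rightarrow> real"
proof -
  have "expectation (\<lambda>\<omega>. \<phi> (wait \<omega> i)) = (\<integral>t. \<phi> t \<partial>distr M (count_space UNIV) (\<lambda>\<omega>. wait \<omega> i))" for i
    by (subst integral_distr) auto
  then show ?thesis by (metis wait_distr)
qed

lemma integrable_wait: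
  fixes \<phi> :: "nat \<Rightarrow> real"
  assumes "integrable M (\<lambda>\<omega>. \<phi> (wait \<omega> 0))"
  shows "integrable M (\<lambda>\<omega>. \<phi> (wait \<omega> i))"
proof -
  have "integrable M (\<lambda>\<omega>. \<phi> (wait \<omega> i)) = integrable (distr M (count_space UNIV) (\<lambda>\<omega>. wait \<omega> i)) \<phi>" for i
    by (subst integrable_distr_eq) auto
  then show ?thesis using assms by (metis wait_distr)
qed

lemma prob_wait: "prob {\<omega> \<in> space M. wait \<omega> i = t} = mu t"
  using tau_law[of "Suc i"] by (simp add: wait_def)

text \<open>This is where the finite mean of the waiting times enters: functions of linear growth
  are dominated by it. The series is the shape in which the drift hypothesis is given.\<close>

lemma wait_linear_growth:
  assumes "\<And>t. \<bar>\<phi> t\<bar> \<le> c * real t"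
  shows "integrable M (\<lambda>\<omega>. \<phi> (wait \<omega> i))"
    and "expectation (\<lambda>\<omega>. \<phi> (wait \<omega> i)) = (\<Sum>t. mu t * \<phi> t)"
proof -
  have mu_nn: "0 \<le> mu t" for t using prob_wait[of 0 t] by (metis measure_nonneg)
  have ev: "(\<lambda>\<omega>. wait \<omega> i) -` {t} \<inter> space M = {\<omega> \<in> space M. wait \<omega> i = t}" for t by auto
  have D: "distr M (count_space UNIV) (\<lambda>\<omega>. wait \<omega> i) = density (count_space UNIV) (\<lambda>t. ennreal (mu t))"
  proof (rule measure_eqI_countable[of _ UNIV])
    show "emeasure (distr M (count_space UNIV) (\<lambda>\<omega>. wait \<omega> i)) {t}
        = emeasure (density (count_space UNIV) (\<lambda>t. ennreal (mu t))) {t}" for t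
      by (simp add: emeasure_distr ev emeasure_eq_measure prob_wait emeasure_density nn_integral_indicator_singleton)
  qed auto
  have "summable (\<lambda>t. norm (mu t * \<phi> t))"
  proof (rule summable_comparison_test'[OF summable_mult[OF mu_mean, of c]])
    show "norm (norm (mu t * \<phi> t)) \<le> c * (real t * mu t)" for t
      using mult_left_mono[OF assms[of t] mu_nn[of t]] mu_nn[of t] by (simp add: abs_mult mult_ac)
  qed
  then have int: "integrable (count_space UNIV) (\<lambda>t. mu t * \<phi> t)"
    by (simp only: integrable_count_space_nat_iff)
  have "integrable (distr M (count_space UNIV) (\<lambda>\<omega>. wait \<omega> i)) \<phi>"
    unfolding D using int mu_nn by (subst integrable_density) auto
  then show "integrable M (\<lambda>\<omega>. \<phi> (wait \<omega> i))"
    by (subst (asm) integrable_distr_eq) auto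
  have "expectation (\<lambda>\<omega>. \<phi> (wait \<omega> i)) = (\<integral>t. \<phi> t \<partial>distr M (count_space UNIV) (\<lambda>\<omega>. wait \<omega> i))"
    by (subst integral_distr) auto
  also have "\<dots> = (\<Sum>t. mu t * \<phi> t)"
    unfolding D using mu_nn by (subst integral_density) (auto simp: integral_count_space_nat[OF int])
  finally show "expectation (\<lambda>\<omega>. \<phi> (wait \<omega> i)) = (\<Sum>t. mu t * \<phi> t)" .
qed

lemma wait_pos: "AE \<omega> in M. \<forall>i. 0 < wait \<omega> i"
proof -
  have "AE \<omega> in M. 0 < wait \<omega> i" for i
    by (rule AE_I[where N = "{\<omega> \<in> space M. wait \<omega> i = 0}"])
      (auto simp: emeasure_eq_measure prob_wait mu_0)
  then show ?thesis by (simp add: AE_all_countable)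
qed

text \<open>Garsia's argument: on the event that the maximum \<open>m\<^sub>n\<close> of the first partial sums is positive it
  exceeds the shifted maximum by the first summand at most, and both maxima have the same mean.\<close>

lemma maximal_inequality:
  fixes \<phi> :: "nat \<Rightarrow> real"
  assumes nn: "\<And>t. 0 \<le> \<phi> t" and int: "integrable M (\<lambda>\<omega>. \<phi> (wait \<omega> 0))" and c: "0 < c"
  shows "prob {\<omega>\<in>space M. \<exists>n. c * real n < (\<Sum>i<n. \<phi> (wait \<omega> i))} \<le> expectation (\<lambda>\<omega>. \<phi> (wait \<omega> 0)) / c"
proof -
  \<comment> \<open>Centring at \<open>c\<close> turns an average above \<open>c\<close> into a
    positive partial sum.\<close>
  define W where "W t = \<phi> t - c" for t
  define A where "A n = {\<omega>\<in>space M. 0 < max_partial_sum W n (wait \<omega>)}" for n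
  have mx_meas [measurable]: "(\<lambda>\<omega>. max_partial_sum W n (wait \<omega>)) \<in> borel_measurable M" for n
    by (rule measurable_compose[OF wait_measurable max_partial_sum_measurable])
  have shift_meas: "(\<lambda>\<omega> i. wait \<omega> (Suc i)) \<in> measurable M seq_space"
    by (rule measurable_PiM_single') (auto simp: space_PiM)
  have mx_shift_meas [measurable]: "(\<lambda>\<omega>. max_partial_sum W n (\<lambda>i. wait \<omega> (Suc i))) \<in> borel_measurable M" for n
    by (rule measurable_compose[OF shift_meas max_partial_sum_measurable])
  have A [measurable]: "A n \<in> sets M" for n unfolding A_def by measurable
  have W_int: "integrable M (\<lambda>\<omega>. W (wait \<omega> i))" for i
    using integrable_wait[OF int] by (simp add: W_def)
  have mx_int: "integrable M (\<lambda>\<omega>. max_partial_sum W n (\<lambda>i. wait \<omega> (i + a)))"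
    if [measurable]: "(\<lambda>\<omega>. max_partial_sum W n (\<lambda>i. wait \<omega> (i + a))) \<in> borel_measurable M" for n a
  proof (rule Bochner_Integration.integrable_bound)
    show "integrable M (\<lambda>\<omega>. \<Sum>i<n. \<bar>W (wait \<omega> (i + a))\<bar>)" using W_int by auto
    show "AE \<omega> in M. norm (max_partial_sum W n (\<lambda>i. wait \<omega> (i + a))) \<le> norm (\<Sum>i<n. \<bar>W (wait \<omega> (i + a))\<bar>)"
      using max_partial_sum_le[of W n] max_partial_sum_nonneg[of W n] by (auto simp: sum_nonneg)
  qed measurable
  have int0: "integrable M (\<lambda>\<omega>. max_partial_sum W n (wait \<omega>))"
    and int1: "integrable M (\<lambda>\<omega>. max_partial_sum W n (\<lambda>i. wait \<omega> (Suc i)))" for n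
    using mx_int[of n 0] mx_int[of n 1] mx_meas[of n] mx_shift_meas[of n] by simp_all
  have E_shift: "expectation (\<lambda>\<omega>. max_partial_sum W n (\<lambda>i. wait \<omega> (Suc i))) = expectation (\<lambda>\<omega>. max_partial_sum W n (wait \<omega>))" for n
  proof -
    have "expectation (\<lambda>\<omega>. max_partial_sum W n (\<lambda>i. wait \<omega> (Suc i))) = (\<integral>u. max_partial_sum W n u \<partial>distr M seq_space (\<lambda>\<omega> i. wait \<omega> (Suc i)))"
      by (rule integral_distr[symmetric, OF shift_meas max_partial_sum_measurable])
    also have "\<dots> = (\<integral>u. max_partial_sum W n u \<partial>distr M seq_space wait)"
      using shifted_wait_distr[of 1] by simp
    also have "\<dots> = expectation (\<lambda>\<omega>. max_partial_sum W n (wait \<omega>))"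
      by (rule integral_distr[OF wait_measurable max_partial_sum_measurable])
    finally show ?thesis .
  qed
  have bound: "prob (A (Suc n)) \<le> expectation (\<lambda>\<omega>. \<phi> (wait \<omega> 0)) / c" for n
  proof -
    have "0 \<le> expectation (\<lambda>\<omega>. max_partial_sum W (Suc n) (wait \<omega>)) - expectation (\<lambda>\<omega>. max_partial_sum W n (wait \<omega>))"
      using integral_mono[OF int0 int0 max_partial_sum_mono] by simp
    also have "\<dots> = expectation (\<lambda>\<omega>. max_partial_sum W (Suc n) (wait \<omega>) - max_partial_sum W n (\<lambda>i. wait \<omega> (Suc i)))"
      by (subst Bochner_Integration.integral_diff[OF int0 int1]) (simp only: E_shift)
    also have "\<dots> \<le> expectation (\<lambda>\<omega>. \<phi> (wait \<omega> 0) - c * indicator (A (Suc n)) \<omega>)"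
    proof (rule integral_mono)
      show "integrable M (\<lambda>\<omega>. max_partial_sum W (Suc n) (wait \<omega>) - max_partial_sum W n (\<lambda>i. wait \<omega> (Suc i)))"
        by (rule Bochner_Integration.integrable_diff[OF int0 int1])
      show "integrable M (\<lambda>\<omega>. \<phi> (wait \<omega> 0) - c * indicator (A (Suc n)) \<omega>)"
        using int by (auto simp: emeasure_eq_measure)
      fix \<omega> assume "\<omega> \<in> space M"
      \<comment> \<open>On \<open>A (Suc n)\<close> the left side equals \<open>\<phi> - c\<close>
        at the first waiting time. Off it the longer maximum is 0, so the left side is at most 0,
        hence at most \<open>\<phi>\<close>.\<close>
      then show "max_partial_sum W (Suc n) (wait \<omega>) - max_partial_sum W n (\<lambda>i. wait \<omega> (Suc i)) \<le> \<phi> (wait \<omega> 0) - c * indicator (A (Suc n)) \<omega>"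
        using nn[of "wait \<omega> 0"] max_partial_sum_nonneg[of W n "\<lambda>i. wait \<omega> (Suc i)"]
        by (auto simp: A_def indicator_def W_def max_def)
    qed
    also have "\<dots> = expectation (\<lambda>\<omega>. \<phi> (wait \<omega> 0)) - c * prob (A (Suc n))"
      using int by (subst Bochner_Integration.integral_diff) (auto simp: emeasure_eq_measure)
    finally show ?thesis using c by (simp add: field_simps)
  qed
  have inc: "incseq (\<lambda>n. A (Suc n))"
  proof (rule incseq_SucI)
    show "A (Suc n) \<subseteq> A (Suc (Suc n))" for n
      using max_partial_sum_mono[of W "Suc n"] unfolding A_def by (auto intro: less_le_trans)
  qed
  have "(\<lambda>n. prob (A (Suc n))) \<longlonglongrightarrow> prob (\<Union>n. A (Suc n))"
    by (rule finite_Lim_measure_incseq) (auto intro: inc)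
  then have "prob (\<Union>n. A (Suc n)) \<le> expectation (\<lambda>\<omega>. \<phi> (wait \<omega> 0)) / c"
    by (rule LIMSEQ_le_const2) (use bound in auto)
  moreover have "{\<omega>\<in>space M. \<exists>n. c * real n < (\<Sum>i<n. \<phi> (wait \<omega> i))} \<subseteq> (\<Union>n. A (Suc n))"
  proof safe
    fix \<omega> n assume \<omega>: "\<omega> \<in> space M" and lt: "c * real n < (\<Sum>i<n. \<phi> (wait \<omega> i))"
    have "0 < (\<Sum>i<n. W (wait \<omega> i))" using lt by (simp add: W_def sum_subtractf mult.commute)
    also have "\<dots> \<le> max_partial_sum W (Suc n) (wait \<omega>)" by (rule sum_le_max_partial_sum) simp
    finally show "\<omega> \<in> (\<Union>n. A (Suc n))" using \<omega> unfolding A_def by blast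
  qed
  ultimately show ?thesis
    by (meson A finite_measure_mono order_trans sets.countable_UN image_subsetI)
qed

section \<open>Functions of the waiting times: independence of the past and limits\<close>

lemma wait_past_indep:
  fixes c :: "(nat \<Rightarrow> nat) \<Rightarrow> real" and \<phi> :: "nat \<Rightarrow> real"
  assumes c: "c \<in> borel_measurable seq_space"
    and dep: "\<And>u u'. (\<And>i. i < n \<Longrightarrow> u i = u' i) \<Longrightarrow> c u = c u'"
    and c_bd: "\<And>u. \<bar>c u\<bar> \<le> a" and \<phi>_bd: "\<And>t. \<bar>\<phi> t\<bar> \<le> b"
  shows "integrable M (\<lambda>\<omega>. c (wait \<omega>) * \<phi> (wait \<omega> n))"
    and "expectation (\<lambda>\<omega>. c (wait \<omega>) * \<phi> (wait \<omega> n)) = expectation (\<lambda>\<omega>. c (wait \<omega>)) * expectation (\<lambda>\<omega>. \<phi> (wait \<omega> 0))"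
proof -
  have "indep_var (PiM {..<n} (\<lambda>_. count_space UNIV)) (\<lambda>\<omega>. restrict (\<lambda>i. wait \<omega> i) {..<n})
      (PiM {n} (\<lambda>_. count_space UNIV)) (\<lambda>\<omega>. restrict (\<lambda>i. wait \<omega> i) {n})"
    using indep_var_restrict[OF shifted_wait_indep[of 0], of "{..<n}" "{n}"] by simp
  \<comment> \<open>Only the first \<open>n\<close> coordinates are available, so the sequence is
    padded with 0; by \<open>dep\<close> the padding does not affect \<open>c\<close>.\<close>
  moreover have "(\<lambda>v. c (\<lambda>i. if i < n then v i else 0)) \<in> borel_measurable (PiM {..<n} (\<lambda>_. count_space UNIV))"
  proof (rule measurable_compose[OF _ c])
    show "(\<lambda>v i. if i < n then v i else 0) \<in> measurable (PiM {..<n} (\<lambda>_. count_space UNIV)) seq_space"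
    proof (rule measurable_PiM_single')
      show "(\<lambda>v. if i < n then v i else 0) \<in> measurable (PiM {..<n} (\<lambda>_. count_space UNIV)) (count_space UNIV)" for i
        by (cases "i < n") auto
    qed (auto simp: space_PiM)
  qed
  moreover have "(\<lambda>v. \<phi> (v n)) \<in> borel_measurable (PiM {n} (\<lambda>_. count_space UNIV))"
    by (rule measurable_compose[where N = "count_space UNIV"]) auto
  ultimately have "indep_var borel ((\<lambda>v. c (\<lambda>i. if i < n then v i else 0)) \<circ> (\<lambda>\<omega>. restrict (\<lambda>i. wait \<omega> i) {..<n}))
      borel ((\<lambda>v. \<phi> (v n)) \<circ> (\<lambda>\<omega>. restrict (\<lambda>i. wait \<omega> i) {n}))"
    by (rule indep_var_compose)
  moreover have "(\<lambda>v. c (\<lambda>i. if i < n then v i else 0)) \<circ> (\<lambda>\<omega>. restrict (\<lambda>i. wait \<omega> i) {..<n}) = (\<lambda>\<omega>. c (wait \<omega>))"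
    by (auto simp: fun_eq_iff intro: dep)
  moreover have "(\<lambda>v. \<phi> (v n)) \<circ> (\<lambda>\<omega>. restrict (\<lambda>i. wait \<omega> i) {n}) = (\<lambda>\<omega>. \<phi> (wait \<omega> n))"
    by (auto simp: fun_eq_iff)
  ultimately have ind: "indep_var borel (\<lambda>\<omega>. c (wait \<omega>)) borel (\<lambda>\<omega>. \<phi> (wait \<omega> n))" by simp
  have int1: "integrable M (\<lambda>\<omega>. c (wait \<omega>))"
    using c_bd measurable_compose[OF wait_measurable c] by (intro integrable_const_bound[of _ a]) auto
  have int2: "integrable M (\<lambda>\<omega>. \<phi> (wait \<omega> n))"
    using \<phi>_bd by (intro integrable_const_bound[of _ b]) auto
  show "integrable M (\<lambda>\<omega>. c (wait \<omega>) * \<phi> (wait \<omega> n))"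
    by (rule indep_var_integrable[OF ind int1 int2])
  show "expectation (\<lambda>\<omega>. c (wait \<omega>) * \<phi> (wait \<omega> n)) = expectation (\<lambda>\<omega>. c (wait \<omega>)) * expectation (\<lambda>\<omega>. \<phi> (wait \<omega> 0))"
    unfolding indep_var_lebesgue_integral[OF ind int1 int2] expectation_wait[of \<phi> n] ..
qed

lemma wait_fun_dominated:
  fixes \<phi> :: "nat \<Rightarrow> nat \<Rightarrow> real"
  assumes bd: "\<And>m t. \<bar>\<phi> m t\<bar> \<le> c * real t" and lim: "\<And>t. (\<lambda>m. \<phi> m t) \<longlonglongrightarrow> \<psi> t"
  shows "(\<lambda>m. expectation (\<lambda>\<omega>. \<phi> m (wait \<omega> 0))) \<longlonglongrightarrow> expectation (\<lambda>\<omega>. \<psi> (wait \<omega> 0))"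
proof (rule integral_dominated_convergence[where w = "\<lambda>\<omega>. c * real (wait \<omega> 0)"])
  have "0 \<le> c" using bd[of 0 1] by simp
  then show "integrable M (\<lambda>\<omega>. c * real (wait \<omega> 0))"
    using wait_linear_growth(1)[of "\<lambda>t. c * real t" c] by simp
qed (use bd lim in auto)

text \<open>Subtraction on the naturals is the positive part here: the excess is dominated by the
  integrable waiting time and is eventually 0 for each value of it.\<close>

lemma tail_mean_vanishes: "(\<lambda>m. expectation (\<lambda>\<omega>. real (wait \<omega> 0 - m))) \<longlonglongrightarrow> 0"
proof -
  have "(\<lambda>m. real (t - m)) \<longlonglongrightarrow> 0" for t
    by (rule tendsto_eventually) (auto intro: eventually_mono[OF eventually_ge_at_top[of t]])
  then have "(\<lambda>m. expectation (\<lambda>\<omega>. real (wait \<omega> 0 - m))) \<longlonglongrightarrow> expectation (\<lambda>\<omega>. 0)"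
    by (intro wait_fun_dominated[of "\<lambda>m t. real (t - m)" 1 "\<lambda>_. 0"]) auto
  then show ?thesis by simp
qed

section \<open>Poisson's equation for the chain at observation instants\<close>

lemma mop_wait_integrable [simp]: "integrable M (\<lambda>\<omega>. mop p (wait \<omega> i) f y)"
  by (rule integrable_const_bound[of _ "\<Sum>j\<in>UNIV. \<bar>f j\<bar>"])
    (auto intro: abs_mop_le[OF stoch] abs_le_sum_abs)

lemma mu_pos: "\<exists>t>0. 0 < mu t"
proof (rule ccontr)
  assume neg: "\<not> (\<exists>t>0. 0 < mu t)"
  have "mu t = 0" for t
  proof -
    have "0 \<le> mu t" using prob_wait[of 0 t] by (metis measure_nonneg)
    moreover have "t = 0 \<or> mu t \<le> 0" using neg by (auto simp: not_less)
    ultimately show ?thesis using mu_0 by auto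
  qed
  then have "AE \<omega> in M. wait \<omega> 0 \<noteq> t" for t
    by (intro AE_I[where N = "{\<omega> \<in> space M. wait \<omega> 0 = t}"]) (auto simp: emeasure_eq_measure prob_wait)
  then have "AE \<omega> in M. \<forall>t. wait \<omega> 0 \<noteq> t" unfolding AE_all_countable by blast
  then have "AE \<omega> in M. False" by eventually_elim blast
  then show False by simp
qed

text \<open>Where \<open>f\<close> attains its maximum \<open>c\<close>, the nonnegative variable
  \<open>c - mop p (wait \<omega> 0) f x\<close> has mean 0, hence vanishes almost surely, in
  particular for one waiting time \<open>t\<close> of positive probability. The maximum principle
  for steps of that single length \<open>t\<close> finishes the argument.\<close>

lemma harmonic_const:
  assumes "\<And>y. expectation (\<lambda>\<omega>. mop p (wait \<omega> 0) f y) = f y"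
  shows "f x = f y"
proof -
  obtain t where t: "0 < t" "0 < mu t" using mu_pos by blast
  define c where "c = Max (range f)"
  have le: "f x \<le> c" for x by (simp add: c_def)
  have "c \<in> range f" unfolding c_def by (rule Max_in) auto
  then obtain x0 where x0: "f x0 = c" by auto
  have cl: "mop p t f x = c" if x: "f x = c" for x
  proof -
    have le': "mop p n f x \<le> c" for n
      using mop_mono[OF stoch, of f "\<lambda>_. c"] le mop_const[OF stoch] by simp
    have "expectation (\<lambda>\<omega>. c - mop p (wait \<omega> 0) f x) = 0"
      using assms[of x] x by (simp add: prob_space)
    then have "AE \<omega> in M. c - mop p (wait \<omega> 0) f x = 0"
      using le' by (subst (asm) integral_nonneg_eq_0_iff_AE) auto
    moreover have "\<not> (AE \<omega> in M. wait \<omega> 0 \<noteq> t)"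
      using t prob_wait[of 0 t]
      by (subst AE_iff_measurable[OF _ refl]) (auto simp: emeasure_eq_measure)
    moreover have "AE \<omega> in M. wait \<omega> 0 \<noteq> t"
      if "c - mop p t f x \<noteq> 0" "AE \<omega> in M. c - mop p (wait \<omega> 0) f x = 0"
      using that(2) by eventually_elim (use that(1) in auto)
    ultimately show ?thesis by auto
  qed
  show ?thesis
    using argmax_spreads[OF stoch irred aper t(1) le x0 cl] by simp
qed

text \<open>With \<open>Q\<close> the transition operator, \<open>f \<mapsto> f - Q f + \<pi> f\<close> is injective by the previous lemma, hence onto,
  and \<open>\<pi>\<close> applied to a preimage \<open>f\<close> of \<open>h\<close> shows \<open>\<pi> f = \<pi> h\<close>.\<close>

lemma poisson_equation:
  obtains f where "\<And>y. h y + expectation (\<lambda>\<omega>. mop p (wait \<omega> 0) f y) - f y = (\<Sum>i\<in>UNIV. \<pi> i * h i)"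
proof -
  define Q where "Q f y = expectation (\<lambda>\<omega>. mop p (wait \<omega> 0) f y)" for f y
  have Q_add: "Q (\<lambda>j. f j + g j) y = Q f y + Q g y" for f g y
    by (simp add: Q_def mop_add_fun)
  have Q_scale: "Q (\<lambda>j. c * f j) y = c * Q f y" for c f y
    by (simp add: Q_def mop_scale)
  have \<pi>1: "(\<Sum>i\<in>UNIV. \<pi> i) = 1" using invar by (simp add: invariant_dist_def)
  have \<pi>Q: "(\<Sum>i\<in>UNIV. \<pi> i * Q f i) = (\<Sum>i\<in>UNIV. \<pi> i * f i)" for f
  proof -
    have "(\<Sum>i\<in>UNIV. \<pi> i * Q f i) = expectation (\<lambda>\<omega>. \<Sum>i\<in>UNIV. \<pi> i * mop p (wait \<omega> 0) f i)"
      by (simp add: Q_def)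
    also have "\<dots> = (\<Sum>i\<in>UNIV. \<pi> i * f i)"
      by (simp add: invariant_mop[OF invar] prob_space)
    finally show ?thesis .
  qed
  \<comment> \<open>Functions on the modes are read as vectors so that injectivity yields
    surjectivity by dimension. The rank-one term removes the constants from the kernel.\<close>
  define T :: "real^'i \<Rightarrow> real^'i" where "T v = (\<chi> y. v $ y - Q (($) v) y + (\<Sum>i\<in>UNIV. \<pi> i * v $ i))" for v
  have \<pi>T: "(\<Sum>i\<in>UNIV. \<pi> i * T v $ i) = (\<Sum>i\<in>UNIV. \<pi> i * v $ i)" for v
  proof -
    have "(\<Sum>i\<in>UNIV. \<pi> i * T v $ i) = (\<Sum>i\<in>UNIV. \<pi> i * v $ i) - (\<Sum>i\<in>UNIV. \<pi> i * Q (($) v) i)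
        + (\<Sum>i\<in>UNIV. \<pi> i) * (\<Sum>i\<in>UNIV. \<pi> i * v $ i)"
      by (simp add: T_def algebra_simps sum.distrib sum_subtractf sum_distrib_right)
    then show ?thesis by (simp add: \<pi>1 \<pi>Q)
  qed
  have "linear T"
  proof (rule linearI)
    fix a b :: "real^'i" and c :: real
    have ab: "($) (a + b) = (\<lambda>j. a $ j + b $ j)" and ca: "($) (c *\<^sub>R a) = (\<lambda>j. c * a $ j)"
      by auto
    show "T (a + b) = T a + T b"
      by (simp add: T_def vec_eq_iff ab Q_add algebra_simps sum.distrib)
    show "T (c *\<^sub>R a) = c *\<^sub>R T a"
      by (simp add: T_def vec_eq_iff ca Q_scale algebra_simps sum_distrib_left)
  qed
  moreover have "inj T"
    unfolding linear_injective_0[OF \<open>linear T\<close>]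
  proof (intro allI impI)
    fix v assume v: "T v = 0"
    \<comment> \<open>Since \<open>\<pi>\<close> applied to \<open>T v\<close> is
      \<open>\<pi>\<close> applied to \<open>v\<close>, the rank-one term vanishes; \<open>v\<close>
      is then harmonic, hence constant, and the constant is the \<open>\<pi>\<close>-mean 0.\<close>
    then have s0: "(\<Sum>i\<in>UNIV. \<pi> i * v $ i) = 0" using \<pi>T[of v] by simp
    have "v $ y - Q (($) v) y + (\<Sum>i\<in>UNIV. \<pi> i * v $ i) = 0" for y
      using v by (simp add: T_def vec_eq_iff)
    then have "Q (($) v) y = v $ y" for y by (simp add: s0)
    then have const: "v $ x = v $ y" for x y using harmonic_const[of "($) v" x y] by (simp add: Q_def)
    have "v $ y = 0" for y
    proof -
      have "(\<Sum>i\<in>UNIV. \<pi> i * v $ i) = (\<Sum>i\<in>UNIV. \<pi> i * v $ y)" 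
        by (intro sum.cong refl arg_cong2[where f = "(*)"] const)
      also have "\<dots> = v $ y" by (simp add: \<pi>1 flip: sum_distrib_right)
      finally show ?thesis using s0 by simp
    qed
    then show "v = 0" by (simp add: vec_eq_iff)
  qed
  ultimately have "surj T" by (rule linear_injective_imp_surjective) (rule refl)
  then obtain v where v: "T v = (\<chi> y. h y)" by (metis surjD)
  have "(\<Sum>i\<in>UNIV. \<pi> i * v $ i) = (\<Sum>i\<in>UNIV. \<pi> i * h i)" using \<pi>T[of v] by (simp add: v)
  moreover have "v $ y - Q (($) v) y + (\<Sum>i\<in>UNIV. \<pi> i * v $ i) = h y" for y
    using v by (simp add: T_def vec_eq_iff)
  ultimately have "h y + Q (($) v) y - v $ y = (\<Sum>i\<in>UNIV. \<pi> i * h i)" for y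
    by (smt (verit))
  then show ?thesis using that[of "($) v"] by (simp add: Q_def)
qed

end

section \<open>Exponential moments of the truncated block sums\<close>

definition obs_at :: "(nat \<Rightarrow> nat) \<Rightarrow> nat \<Rightarrow> nat" where
  "obs_at u n = (\<Sum>j<n. u j)"

text \<open>The block after the \<open>n\<close>-th observation, cut off after \<open>m\<close>
  steps; the second argument of \<open>g\<close> stays frozen at the observed mode. The condition
  \<open>l < u n\<close> sits inside the sum so that its range does not depend on the waiting
  times.\<close>

definition block :: "('i \<Rightarrow> 'i \<Rightarrow> real) \<Rightarrow> nat \<Rightarrow> (nat \<Rightarrow> nat) \<Rightarrow> (nat \<Rightarrow> 'i) \<Rightarrow> nat \<Rightarrow> real" where
  "block g m u \<rho> n = (\<Sum>l<m. if l < u n then g (\<rho> (obs_at u n + l)) (\<rho> (obs_at u n)) else 0)"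

text \<open>The corrector appears only once because its increments telescope. Its initial value is
  not subtracted, which costs at most a factor \<open>exp (s * Fb)\<close> when \<open>f\<close> is
  bounded by \<open>Fb\<close> and \<open>s\<close> is nonnegative.\<close>

definition block_exp :: "('i \<Rightarrow> 'i \<Rightarrow> real) \<Rightarrow> nat \<Rightarrow> real \<Rightarrow> ('i \<Rightarrow> real) \<Rightarrow> nat \<Rightarrow> (nat \<Rightarrow> nat) \<Rightarrow> (nat \<Rightarrow> 'i) \<Rightarrow> real" where
  "block_exp g m s f n u \<rho> = exp (s * ((\<Sum>i<n. block g m u \<rho> i) + f (\<rho> (obs_at u n))))"

lemma obs_at_Suc: "obs_at u (Suc n) = obs_at u n + u n"
  by (simp add: obs_at_def)

lemma obs_at_mono: "i \<le> n \<Longrightarrow> obs_at u i \<le> obs_at u n"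
  unfolding obs_at_def by (rule sum_mono2) auto

lemma abs_block_le:
  assumes "\<And>i j. \<bar>g j i\<bar> \<le> G"
  shows "\<bar>block g m u \<rho> n\<bar> \<le> G * real m"
proof -
  have "0 \<le> G" using assms abs_ge_zero order_trans by blast
  then have "\<bar>block g m u \<rho> n\<bar> \<le> (\<Sum>l<m. G)"
    unfolding block_def using assms by (intro order_trans[OF sum_abs] sum_mono) auto
  then show ?thesis by (simp add: mult.commute)
qed

lemma block_cong_wait:
  assumes "\<And>i. i < n \<Longrightarrow> u i = u' i" "k < n"
  shows "block g m u \<rho> k = block g m u' \<rho> k"
proof -
  have "obs_at u k = obs_at u' k" using assms by (auto simp: obs_at_def intro!: sum.cong)
  moreover have "u k = u' k" using assms by simp
  ultimately show ?thesis by (simp add: block_def cong: if_cong)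
qed

lemma obs_at_measurable [measurable]:
  "(\<lambda>x. obs_at (snd x) n) \<in> measurable (seq_space \<Otimes>\<^sub>M seq_space) (count_space UNIV)"
proof (induction n)
  case (Suc n)
  show ?case unfolding obs_at_Suc
    by (rule measurable_fun2[where h = "(+)", OF Suc]) auto
qed (simp add: obs_at_def)

lemma path_at_obs_measurable [measurable]:
  "(\<lambda>x. fst x (obs_at (snd x) n + l)) \<in> measurable (seq_space \<Otimes>\<^sub>M seq_space) (count_space UNIV)"
  by (rule measurable_compose_countable[where f = "\<lambda>k x. fst x (k + l)" and g = "\<lambda>x. obs_at (snd x) n"]) measurable

lemma block_measurable [measurable]:
  fixes g :: "'i::finite \<Rightarrow> 'i \<Rightarrow> real"
  shows "(\<lambda>x. block g m (snd x) (fst x) n) \<in> borel_measurable (seq_space \<Otimes>\<^sub>M seq_space)"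
proof -
  have [measurable]: "(\<lambda>x. g (fst x (obs_at (snd x) n + l)) (fst x (obs_at (snd x) n)))
      \<in> borel_measurable (seq_space \<Otimes>\<^sub>M seq_space)" for l
    by (rule measurable_fun2[where h = g]) (use path_at_obs_measurable[of n 0] in auto)
  show ?thesis unfolding block_def by measurable
qed

lemma block_exp_measurable [measurable]:
  fixes g :: "'i::finite \<Rightarrow> 'i \<Rightarrow> real"
  shows "(\<lambda>x. block_exp g m s f n (snd x) (fst x)) \<in> borel_measurable (seq_space \<Otimes>\<^sub>M seq_space)"
proof -
  have [measurable]: "(\<lambda>x. f (fst x (obs_at (snd x) n))) \<in> borel_measurable (seq_space \<Otimes>\<^sub>M seq_space)"
    by (rule measurable_compose[where N = "count_space UNIV"]) (use path_at_obs_measurable[of n 0] in auto)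
  show ?thesis unfolding block_exp_def by measurable
qed

text \<open>In the application \<open>g j i\<close> is \<open>ln (\<zeta> j i)\<close>, with
  \<open>j\<close> the current mode and \<open>i\<close> the mode last observed.\<close>

locale rewarded_chain = sampled_chain M r r0 p \<pi> tau mu
  for M :: "'w measure" and r :: "nat \<Rightarrow> 'w \<Rightarrow> 'i::finite" and r0 p \<pi> tau mu +
  fixes g :: "'i \<Rightarrow> 'i \<Rightarrow> real" and G :: real
  assumes g_bound: "\<And>i j. \<bar>g j i\<bar> \<le> G"
begin

lemma G_nonneg: "0 \<le> G"
  using g_bound abs_ge_zero order_trans by blast

text \<open>The conditional mean, given the mode \<open>y\<close> at an observation and the
  following waiting time \<open>t\<close>, of the truncated block sum plus the increment of the
  corrector.\<close>

definition corrected_drift :: "nat \<Rightarrow> ('i \<Rightarrow> real) \<Rightarrow> nat \<Rightarrow> 'i \<Rightarrow> real" where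
  "corrected_drift m f t y = (\<Sum>l<m. if l < t then mop p l (\<lambda>j. g j y) y else 0) + mop p t f y - f y"

text \<open>Once the waiting times are frozen, \<open>obs_at u n\<close> is a plain number, so
  adaptedness refers to a deterministic time and no stopping times are involved.\<close>

lemma block_determined: "k < n \<Longrightarrow> determined_by (obs_at u n) (\<lambda>\<rho>. block g m u \<rho> k)"
  unfolding determined_by_def
proof safe
  fix s s' :: "nat \<Rightarrow> 'i" assume k: "k < n" and eq: "\<forall>t\<le>obs_at u n. s t = s' t"
  have "obs_at u k + u k \<le> obs_at u n" using obs_at_mono[of "Suc k" n u] k by (simp add: obs_at_Suc)
  then have "s (obs_at u k + l) = s' (obs_at u k + l)" if "l \<le> u k" for l using eq that by simp
  from this this[of 0] show "block g m u s k = block g m u s' k" by (simp add: block_def cong: if_cong)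
qed

lemma block_exp_determined: "determined_by (obs_at u n) (block_exp g m s f n u)"
  unfolding determined_by_def block_exp_def
proof (intro allI impI)
  fix a b :: "nat \<Rightarrow> 'i" assume eq: "\<forall>t\<le>obs_at u n. a t = b t"
  have "(\<Sum>i<n. block g m u a i) = (\<Sum>i<n. block g m u b i)"
    using eq block_determined[of _ n u m] unfolding determined_by_def by (intro sum.cong) auto
  then show "exp (s * ((\<Sum>i<n. block g m u a i) + f (a (obs_at u n))))
      = exp (s * ((\<Sum>i<n. block g m u b i) + f (b (obs_at u n))))"
    using eq by simp
qed

text \<open>Quenched means that the waiting times \<open>u\<close> are frozen and only the modes are averaged; the drift is
  negative only after averaging over the waiting times as well.\<close>

lemma quenched_exp_step:
  assumes f: "\<And>y. \<bar>f y\<bar> \<le> Fb" and C: "G * real m + 2 * Fb \<le> C" and s: "0 \<le> s" "s * C \<le> 1"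
  shows "expectation (\<lambda>\<omega>. block_exp g m s f (Suc n) u (mode \<omega>))
    \<le> expectation (\<lambda>\<omega>. block_exp g m s f n u (mode \<omega>) * (1 + s\<^sup>2 * C\<^sup>2 + s * corrected_drift m f (u n) (mode \<omega> (obs_at u n))))"
proof -
  let ?k = "obs_at u n" and ?Z = "block_exp g m s f n u"
  have Z: "determined_by ?k ?Z" by (rule block_exp_determined)
  have int: "integrable M (\<lambda>\<omega>. ?Z (mode \<omega>) * h (mode \<omega> ?k) (mode \<omega> (?k + l)))" for h l
    by (rule determined_integrable[of "?k + l" "\<lambda>\<rho>. ?Z \<rho> * h (\<rho> ?k) (\<rho> (?k + l))"])
      (use determined_by_mono[OF Z, of "?k + l"] in \<open>auto simp: determined_by_def\<close>)
  have int0: "integrable M (\<lambda>\<omega>. ?Z (mode \<omega>) * h (mode \<omega> ?k))" for h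
    using int[of "\<lambda>x y. h x" 0] by simp
  have int1: "integrable M (\<lambda>\<omega>. ?Z (mode \<omega>))"
    using int0[of "\<lambda>_. 1"] by simp
  \<comment> \<open>The increment of the exponent of \<open>block_exp\<close> over one block, before
    scaling by \<open>s\<close>.\<close>
  define D where "D \<rho> = block g m u \<rho> n + f (\<rho> (?k + u n)) - f (\<rho> ?k)" for \<rho>
  \<comment> \<open>The unreduced abstractions display the two-argument test functions to which
    \<open>markov_property\<close> is applied below.\<close>
  have ZD: "?Z (mode \<omega>) * D (mode \<omega>) =
      (\<Sum>l<m. if l < u n then ?Z (mode \<omega>) * (\<lambda>y j. g j y) (mode \<omega> ?k) (mode \<omega> (?k + l)) else 0)
      + ?Z (mode \<omega>) * (\<lambda>y j. f j) (mode \<omega> ?k) (mode \<omega> (?k + u n)) - ?Z (mode \<omega>) * f (mode \<omega> ?k)" for \<omega>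
    by (simp add: D_def block_def algebra_simps sum_distrib_left if_distrib cong: if_cong)
  have Zw: "?Z (mode \<omega>) * corrected_drift m f (u n) (mode \<omega> ?k) =
      (\<Sum>l<m. if l < u n then ?Z (mode \<omega>) * mop p l ((\<lambda>y j. g j y) (mode \<omega> ?k)) (mode \<omega> ?k) else 0)
      + ?Z (mode \<omega>) * mop p (u n) ((\<lambda>y j. f j) (mode \<omega> ?k)) (mode \<omega> ?k) - ?Z (mode \<omega>) * f (mode \<omega> ?k)" for \<omega>
    by (simp add: corrected_drift_def algebra_simps sum_distrib_left if_distrib cong: if_cong)
  have int_if: "integrable M (\<lambda>\<omega>. if P then h \<omega> else 0)" if "integrable M h" for P and h :: "'w \<Rightarrow> real"
    using that by (cases P) auto
  have ex_if: "expectation (\<lambda>\<omega>. if P then h \<omega> else 0) = (if P then expectation h else 0)" for P and h :: "'w \<Rightarrow> real"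
    by (cases P) auto
  have ZD_int: "integrable M (\<lambda>\<omega>. ?Z (mode \<omega>) * D (mode \<omega>))"
    unfolding ZD
    by (intro Bochner_Integration.integrable_diff Bochner_Integration.integrable_add
        Bochner_Integration.integrable_sum int_if int int0)
  have "expectation (\<lambda>\<omega>. ?Z (mode \<omega>) * D (mode \<omega>)) =
      (\<Sum>l<m. if l < u n then expectation (\<lambda>\<omega>. ?Z (mode \<omega>) * (\<lambda>y j. g j y) (mode \<omega> ?k) (mode \<omega> (?k + l))) else 0)
      + expectation (\<lambda>\<omega>. ?Z (mode \<omega>) * (\<lambda>y j. f j) (mode \<omega> ?k) (mode \<omega> (?k + u n)))
      - expectation (\<lambda>\<omega>. ?Z (mode \<omega>) * f (mode \<omega> ?k))"
    unfolding ZD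
    by (subst Bochner_Integration.integral_diff Bochner_Integration.integral_add Bochner_Integration.integral_sum ex_if;
        (intro Bochner_Integration.integrable_add Bochner_Integration.integrable_sum int_if int int0)?)+ simp
  also have "\<dots> = 
      (\<Sum>l<m. if l < u n then expectation (\<lambda>\<omega>. ?Z (mode \<omega>) * mop p l ((\<lambda>y j. g j y) (mode \<omega> ?k)) (mode \<omega> ?k)) else 0)
      + expectation (\<lambda>\<omega>. ?Z (mode \<omega>) * mop p (u n) ((\<lambda>y j. f j) (mode \<omega> ?k)) (mode \<omega> ?k))
      - expectation (\<lambda>\<omega>. ?Z (mode \<omega>) * f (mode \<omega> ?k))"
    by (simp only: markov_property[OF Z, of "\<lambda>y j. g j y"] markov_property[OF Z, of "\<lambda>y. f"] cong: if_cong)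
  also have "\<dots> = expectation (\<lambda>\<omega>. ?Z (mode \<omega>) * corrected_drift m f (u n) (mode \<omega> ?k))"
    unfolding Zw
    by (subst Bochner_Integration.integral_diff Bochner_Integration.integral_add Bochner_Integration.integral_sum ex_if;
        (intro Bochner_Integration.integrable_add Bochner_Integration.integrable_sum int_if int0)?)+ simp
  finally have drift: "expectation (\<lambda>\<omega>. ?Z (mode \<omega>) * D (mode \<omega>))
      = expectation (\<lambda>\<omega>. ?Z (mode \<omega>) * corrected_drift m f (u n) (mode \<omega> ?k))" .
  have D_le: "\<bar>D \<rho>\<bar> \<le> C" for \<rho>
    using abs_block_le[of g G m u \<rho> n, OF g_bound] f[of "\<rho> (?k + u n)"] f[of "\<rho> ?k"] C unfolding D_def by linarith
  have step: "block_exp g m s f (Suc n) u \<rho> \<le> (1 + s\<^sup>2 * C\<^sup>2) * ?Z \<rho> + s * (?Z \<rho> * D \<rho>)" for \<rho>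
  proof -
    have "\<bar>s * D \<rho>\<bar> \<le> s * C" using D_le[of \<rho>] s by (simp add: abs_mult mult_left_mono)
    then have "exp (s * D \<rho>) \<le> 1 + s * D \<rho> + (s * D \<rho>)\<^sup>2" using s by (intro exp_le_quadratic) linarith
    also have "(s * D \<rho>)\<^sup>2 \<le> (s * C)\<^sup>2" using \<open>\<bar>s * D \<rho>\<bar> \<le> s * C\<close> by (metis abs_ge_zero power2_abs power_mono)
    finally have "exp (s * D \<rho>) \<le> 1 + s * D \<rho> + s\<^sup>2 * C\<^sup>2" by (simp add: power_mult_distrib)
    moreover have "block_exp g m s f (Suc n) u \<rho> = ?Z \<rho> * exp (s * D \<rho>)"
      by (simp add: block_exp_def D_def obs_at_Suc algebra_simps flip: exp_add)
    moreover have "0 \<le> ?Z \<rho>" by (simp add: block_exp_def)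
    ultimately have "block_exp g m s f (Suc n) u \<rho> \<le> ?Z \<rho> * (1 + s * D \<rho> + s\<^sup>2 * C\<^sup>2)"
      by (simp add: mult_left_mono)
    then show ?thesis by (simp add: algebra_simps)
  qed
  have "expectation (\<lambda>\<omega>. block_exp g m s f (Suc n) u (mode \<omega>))
      \<le> expectation (\<lambda>\<omega>. (1 + s\<^sup>2 * C\<^sup>2) * ?Z (mode \<omega>) + s * (?Z (mode \<omega>) * D (mode \<omega>)))"
  proof (rule integral_mono)
    show "integrable M (\<lambda>\<omega>. block_exp g m s f (Suc n) u (mode \<omega>))"
      by (rule determined_integrable[OF block_exp_determined])
    show "integrable M (\<lambda>\<omega>. (1 + s\<^sup>2 * C\<^sup>2) * ?Z (mode \<omega>) + s * (?Z (mode \<omega>) * D (mode \<omega>)))"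
      using int1 ZD_int by (intro Bochner_Integration.integrable_add integrable_mult_right) auto
  qed (rule step)
  also have "\<dots> = (1 + s\<^sup>2 * C\<^sup>2) * expectation (\<lambda>\<omega>. ?Z (mode \<omega>))
      + s * expectation (\<lambda>\<omega>. ?Z (mode \<omega>) * corrected_drift m f (u n) (mode \<omega> ?k))"
    using int1 ZD_int by (simp add: drift)
  also have "\<dots> = expectation (\<lambda>\<omega>. (1 + s\<^sup>2 * C\<^sup>2) * ?Z (mode \<omega>)
      + s * (?Z (mode \<omega>) * corrected_drift m f (u n) (mode \<omega> ?k)))"
    using int1 int0[of "corrected_drift m f (u n)"] by simp
  finally show ?thesis by (simp add: algebra_simps)
qed

lemma block_exp_bounds:
  assumes f: "\<And>y. \<bar>f y\<bar> \<le> Fb" and s: "0 \<le> s"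
  shows "0 \<le> block_exp g m s f n u \<rho>" "block_exp g m s f n u \<rho> \<le> exp (s * (real n * (G * real m) + Fb))"
proof -
  have "(\<Sum>i<n. block g m u \<rho> i) \<le> (\<Sum>i<n. G * real m)"
    using abs_block_le[of g G m u \<rho>, OF g_bound] by (intro sum_mono) (simp add: abs_le_iff)
  then have "(\<Sum>i<n. block g m u \<rho> i) + f (\<rho> (obs_at u n)) \<le> real n * (G * real m) + Fb"
    using f[of "\<rho> (obs_at u n)"] by simp
  then show "block_exp g m s f n u \<rho> \<le> exp (s * (real n * (G * real m) + Fb))"
    using s by (simp add: block_exp_def mult_left_mono)
qed (simp add: block_exp_def)

lemma corrected_drift_bound:
  assumes f: "\<And>y. \<bar>f y\<bar> \<le> Fb"
  shows "\<bar>corrected_drift m f t y\<bar> \<le> G * real m + 2 * Fb"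
proof -
  have "\<bar>\<Sum>l<m. if l < t then mop p l (\<lambda>j. g j y) y else 0\<bar> \<le> (\<Sum>l<m. G)"
    using abs_mop_le[OF stoch, of "\<lambda>j. g j y" G] g_bound G_nonneg
    by (intro order_trans[OF sum_abs] sum_mono) auto
  moreover have "\<bar>mop p t f y\<bar> \<le> Fb" using abs_mop_le[OF stoch f] .
  ultimately show ?thesis using f[of y] unfolding corrected_drift_def by (simp add: mult.commute)
qed

text \<open>The quenched bound involves both the mode at the \<open>n\<close>-th observation and the
  waiting time \<open>u n\<close>. Splitting by that mode separates them: the weight
  \<open>c y u\<close> depends only on the waiting times before \<open>n\<close>, so it is
  independent of \<open>u n\<close>, and the drift factor can be replaced by its mean.\<close>

lemma annealed_exp_step:
  assumes f: "\<And>y. \<bar>f y\<bar> \<le> Fb" and C: "G * real m + 2 * Fb \<le> C" and s: "0 \<le> s" "s * C \<le> 1"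
    and drift: "\<And>y. expectation (\<lambda>\<omega>. corrected_drift m f (wait \<omega> 0) y) \<le> - \<eta>"
  shows "expectation (\<lambda>\<omega>. block_exp g m s f (Suc n) (wait \<omega>) (mode \<omega>))
    \<le> (1 + s\<^sup>2 * C\<^sup>2 - s * \<eta>) * expectation (\<lambda>\<omega>. block_exp g m s f n (wait \<omega>) (mode \<omega>))"
proof -
  let ?Z = "block_exp g m s f" and ?K = "1 + s\<^sup>2 * C\<^sup>2"
  define b where "b n = exp (s * (real n * (G * real m) + Fb))" for n
  have Z_bd: "\<bar>?Z n u \<rho>\<bar> \<le> b n" for n u \<rho>
    using block_exp_bounds[of f Fb s m n u \<rho>, OF f s(1)] by (simp add: b_def)
  have Z_meas: "(\<lambda>(\<rho>, u). ?Z n u \<rho>) \<in> borel_measurable (seq_space \<Otimes>\<^sub>M seq_space)" for n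
    using block_exp_measurable[of g m s f n] by (simp add: split_beta')
  define ZY where "ZY y u \<rho> = ?Z n u \<rho> * (if \<rho> (obs_at u n) = y then 1 else 0)" for y u \<rho>
  have ZY_bd: "\<bar>ZY y u \<rho>\<bar> \<le> b n" for y u \<rho>
    using Z_bd[of n u \<rho>] by (auto simp: ZY_def intro: order_trans[OF abs_ge_zero])
  have ZY_meas: "(\<lambda>(\<rho>, u). ZY y u \<rho>) \<in> borel_measurable (seq_space \<Otimes>\<^sub>M seq_space)" for y
  proof -
    have [measurable]: "(\<lambda>x. fst x (obs_at (snd x) n)) \<in> measurable (seq_space \<Otimes>\<^sub>M (seq_space :: (nat \<Rightarrow> nat) measure)) (count_space (UNIV :: 'i set))"
      using path_at_obs_measurable[of n 0] by simp
    show ?thesis unfolding ZY_def split_beta' by measurable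
  qed
  define c where "c y u = expectation (\<lambda>\<omega>. ZY y u (mode \<omega>))" for y u
  have c_meas: "c y \<in> borel_measurable seq_space" for y
    using expectation_mode_wait(2)[OF ZY_meas ZY_bd] by (simp add: c_def[abs_def])
  have ZY_det: "determined_by (obs_at u n) (ZY y u)" for y u
    using block_exp_determined[of u n m s f] by (auto simp: determined_by_def ZY_def)
  note ZY_int = determined_integrable[OF ZY_det]
  have c_bd: "\<bar>c y u\<bar> \<le> b n" and c_nn: "0 \<le> c y u" for y u
  proof -
    show "0 \<le> c y u" unfolding c_def by (rule Bochner_Integration.integral_nonneg) (simp add: ZY_def block_exp_def)
    moreover have "c y u \<le> expectation (\<lambda>_. b n)"
      unfolding c_def using ZY_bd by (intro integral_mono ZY_int) (auto simp: abs_le_iff)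
    ultimately show "\<bar>c y u\<bar> \<le> b n" by (simp add: prob_space)
  qed
  have c_dep: "c y u = c y u'" if "\<And>i. i < n \<Longrightarrow> u i = u' i" for y u u'
  proof -
    have o: "obs_at u n = obs_at u' n" using that by (auto simp: obs_at_def intro!: sum.cong)
    have "(\<Sum>i<n. block g m u \<rho> i) = (\<Sum>i<n. block g m u' \<rho> i)" for \<rho>
      using block_cong_wait[of n u u', OF that] by (intro sum.cong) auto
    then have "ZY y u = ZY y u'" by (simp add: ZY_def block_exp_def o fun_eq_iff)
    then show ?thesis by (simp add: c_def)
  qed
  define \<phi> where "\<phi> y t = ?K + s * corrected_drift m f t y" for y t
  have \<phi>_bd: "\<bar>\<phi> y t\<bar> \<le> ?K + s * (G * real m + 2 * Fb)" for y t
  proof -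
    have "\<bar>\<phi> y t\<bar> \<le> \<bar>?K\<bar> + \<bar>s * corrected_drift m f t y\<bar>" unfolding \<phi>_def by (rule abs_triangle_ineq)
    also have "\<dots> \<le> ?K + s * (G * real m + 2 * Fb)"
      using corrected_drift_bound[of f Fb m t y, OF f] s by (simp add: abs_mult mult_left_mono)
    finally show ?thesis .
  qed
  have past: "integrable M (\<lambda>\<omega>. c y (wait \<omega>) * \<phi> y (wait \<omega> n))"
    "expectation (\<lambda>\<omega>. c y (wait \<omega>) * \<phi> y (wait \<omega> n)) = expectation (\<lambda>\<omega>. c y (wait \<omega>)) * expectation (\<lambda>\<omega>. \<phi> y (wait \<omega> 0))" for y
    by (rule wait_past_indep[OF c_meas _ c_bd \<phi>_bd], rule c_dep, blast)+
  have drift_int: "integrable M (\<lambda>\<omega>. corrected_drift m f (wait \<omega> 0) y)" for y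
    using corrected_drift_bound[of f Fb m _ y, OF f] by (intro integrable_const_bound[of _ "G * real m + 2 * Fb"]) auto
  have \<phi>_exp: "expectation (\<lambda>\<omega>. \<phi> y (wait \<omega> 0)) \<le> ?K - s * \<eta>" for y
    using drift_int[of y] mult_left_mono[OF drift[of y] s(1)] by (simp add: \<phi>_def prob_space)
  have "expectation (\<lambda>\<omega>. ?Z (Suc n) (wait \<omega>) (mode \<omega>))
      = expectation (\<lambda>\<omega>. expectation (\<lambda>\<omega>'. ?Z (Suc n) (wait \<omega>) (mode \<omega>')))"
    by (rule expectation_mode_wait(1)[OF Z_meas Z_bd])
  also have "\<dots> \<le> expectation (\<lambda>\<omega>. \<Sum>y\<in>UNIV. c y (wait \<omega>) * \<phi> y (wait \<omega> n))"
  proof (rule integral_mono)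
    have "\<bar>expectation (\<lambda>\<omega>'. ?Z (Suc n) u (mode \<omega>'))\<bar> \<le> b (Suc n)" for u
    proof -
      have "0 \<le> expectation (\<lambda>\<omega>'. ?Z (Suc n) u (mode \<omega>'))"
        by (rule Bochner_Integration.integral_nonneg) (simp add: block_exp_def)
      moreover have "expectation (\<lambda>\<omega>'. ?Z (Suc n) u (mode \<omega>')) \<le> expectation (\<lambda>_. b (Suc n))"
        using Z_bd by (intro integral_mono determined_integrable[OF block_exp_determined]) (auto simp: abs_le_iff)
      ultimately show ?thesis by (simp add: prob_space)
    qed
    then show "integrable M (\<lambda>\<omega>. expectation (\<lambda>\<omega>'. ?Z (Suc n) (wait \<omega>) (mode \<omega>')))"
      using measurable_compose[OF wait_measurable expectation_mode_wait(2)[OF Z_meas Z_bd]]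
      by (intro integrable_const_bound[of _ "b (Suc n)"]) auto
    show "integrable M (\<lambda>\<omega>. \<Sum>y\<in>UNIV. c y (wait \<omega>) * \<phi> y (wait \<omega> n))"
      by (intro Bochner_Integration.integrable_sum past)
    fix \<omega>
    let ?u = "wait \<omega>"
    have "expectation (\<lambda>\<omega>'. ?Z (Suc n) ?u (mode \<omega>'))
        \<le> expectation (\<lambda>\<omega>'. ?Z n ?u (mode \<omega>') * (?K + s * corrected_drift m f (?u n) (mode \<omega>' (obs_at ?u n))))"
      by (rule quenched_exp_step[OF f C s])
    also have "\<dots> = expectation (\<lambda>\<omega>'. \<Sum>y\<in>UNIV. ZY y ?u (mode \<omega>') * \<phi> y (?u n))"
    proof (intro Bochner_Integration.integral_cong refl)
      fix \<omega>'
      show "?Z n ?u (mode \<omega>') * (?K + s * corrected_drift m f (?u n) (mode \<omega>' (obs_at ?u n)))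
          = (\<Sum>y\<in>UNIV. ZY y ?u (mode \<omega>') * \<phi> y (?u n))"
        by (subst sum.remove[of _ "mode \<omega>' (obs_at ?u n)"]) (auto simp: ZY_def \<phi>_def intro!: sum.neutral)
    qed
    also have "\<dots> = (\<Sum>y\<in>UNIV. c y ?u * \<phi> y (?u n))"
      unfolding c_def using ZY_int by simp
    finally show "expectation (\<lambda>\<omega>'. ?Z (Suc n) ?u (mode \<omega>')) \<le> (\<Sum>y\<in>UNIV. c y ?u * \<phi> y (?u n))" .
  qed
  also have "\<dots> = (\<Sum>y\<in>UNIV. expectation (\<lambda>\<omega>. c y (wait \<omega>)) * expectation (\<lambda>\<omega>. \<phi> y (wait \<omega> 0)))"
    by (subst Bochner_Integration.integral_sum) (auto simp: past)
  \<comment> \<open>The weights are nonnegative and the drift bound is uniform in \<open>y\<close>,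
    so it can be inserted in every term.\<close>
  also have "\<dots> \<le> (\<Sum>y\<in>UNIV. expectation (\<lambda>\<omega>. c y (wait \<omega>)) * (?K - s * \<eta>))"
    by (intro sum_mono mult_left_mono \<phi>_exp Bochner_Integration.integral_nonneg c_nn)
  also have "\<dots> = (?K - s * \<eta>) * (\<Sum>y\<in>UNIV. expectation (\<lambda>\<omega>. ZY y (wait \<omega>) (mode \<omega>)))"
    by (simp add: expectation_mode_wait(1)[OF ZY_meas ZY_bd] c_def mult.commute flip: sum_distrib_right)
  also have "(\<Sum>y\<in>UNIV. expectation (\<lambda>\<omega>. ZY y (wait \<omega>) (mode \<omega>))) = expectation (\<lambda>\<omega>. \<Sum>y\<in>UNIV. ZY y (wait \<omega>) (mode \<omega>))"
  proof (rule Bochner_Integration.integral_sum[symmetric])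
    show "integrable M (\<lambda>\<omega>. ZY y (wait \<omega>) (mode \<omega>))" for y
    proof (rule integrable_const_bound[of _ "b n"])
      show "(\<lambda>\<omega>. ZY y (wait \<omega>) (mode \<omega>)) \<in> borel_measurable M"
        using measurable_compose[OF measurable_Pair[OF mode_measurable wait_measurable] ZY_meas] by simp
    qed (use ZY_bd in auto)
  qed
  also have "\<dots> = expectation (\<lambda>\<omega>. ?Z n (wait \<omega>) (mode \<omega>))"
  proof (intro Bochner_Integration.integral_cong refl)
    fix \<omega>
    show "(\<Sum>y\<in>UNIV. ZY y (wait \<omega>) (mode \<omega>)) = ?Z n (wait \<omega>) (mode \<omega>)"
      by (subst sum.remove[of _ "mode \<omega> (obs_at (wait \<omega>) n)"]) (auto simp: ZY_def intro!: sum.neutral)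
  qed
  finally show ?thesis .
qed

lemma blocks_drift:
  assumes f: "\<And>y. \<bar>f y\<bar> \<le> Fb" and \<eta>: "0 < \<eta>"
    and drift: "\<And>y. expectation (\<lambda>\<omega>. corrected_drift m f (wait \<omega> 0) y) \<le> - \<eta>"
  shows "AE \<omega> in M. eventually (\<lambda>n. (\<Sum>i<n. block g m (wait \<omega>) (mode \<omega>) i) \<le> - (\<eta> / 4) * real n) sequentially"
proof -
  \<comment> \<open>The summand 1 keeps \<open>C\<close> positive, as it is divided by
    below.\<close>
  define C where "C = G * real m + 2 * Fb + 1"
  have Fb: "0 \<le> Fb" using f abs_ge_zero order_trans by blast
  have C: "0 < C" using G_nonneg Fb by (simp add: C_def add_nonneg_pos)
  \<comment> \<open>The first entry makes the quadratic estimate of the exponential applicable; the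
    second keeps the error \<open>s\<^sup>2 * C\<^sup>2\<close> below half of the gain
    \<open>s * \<eta>\<close>.\<close>
  define s where "s = min (1 / C) (\<eta> / (2 * C\<^sup>2))"
  have s: "0 < s" "s * C \<le> 1" "s * C\<^sup>2 \<le> \<eta> / 2"
  proof -
    show "0 < s" using C \<eta> by (simp add: s_def)
    have "s \<le> 1 / C" "s \<le> \<eta> / (2 * C\<^sup>2)" by (simp_all add: s_def)
    then show "s * C \<le> 1" "s * C\<^sup>2 \<le> \<eta> / 2" using C by (simp_all add: field_simps)
  qed
  let ?Z = "\<lambda>n \<omega>. block_exp g m s f n (wait \<omega>) (mode \<omega>)"
  have Z_meas [measurable]: "?Z n \<in> borel_measurable M" for n
    using measurable_compose[OF measurable_Pair[OF mode_measurable wait_measurable] block_exp_measurable] by simp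
  have Z_int: "integrable M (?Z n)" for n
    using block_exp_bounds[of f Fb s m n, OF f] s(1)
    by (intro integrable_const_bound[of _ "exp (s * (real n * (G * real m) + Fb))"]) auto
  have factor: "1 + s\<^sup>2 * C\<^sup>2 - s * \<eta> \<le> exp (- (s * \<eta> / 2))"
  proof -
    have "s * (s * C\<^sup>2) \<le> s * (\<eta> / 2)" using s by (intro mult_left_mono) auto
    then have "1 + s\<^sup>2 * C\<^sup>2 - s * \<eta> \<le> 1 + (- (s * \<eta> / 2))" by (simp add: power2_eq_square algebra_simps)
    also have "\<dots> \<le> exp (- (s * \<eta> / 2))" by (rule exp_ge_add_one_self)
    finally show ?thesis .
  qed
  have E_bd: "expectation (?Z n) \<le> exp (- (s * \<eta> / 2)) ^ n * exp (s * Fb)" for n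
  proof (induction n)
    case 0
    have "expectation (?Z 0) \<le> expectation (\<lambda>_. exp (s * Fb))"
      using block_exp_bounds(2)[of f Fb s m 0, OF f] s(1) by (intro integral_mono Z_int) auto
    then show ?case by (simp add: prob_space)
  next
    case (Suc n)
    have nn: "0 \<le> expectation (?Z n)" by (rule Bochner_Integration.integral_nonneg) (simp add: block_exp_def)
    have "expectation (?Z (Suc n)) \<le> (1 + s\<^sup>2 * C\<^sup>2 - s * \<eta>) * expectation (?Z n)"
      by (rule annealed_exp_step[OF f _ _ s(2) drift]) (use s in \<open>auto simp: C_def\<close>)
    also have "\<dots> \<le> exp (- (s * \<eta> / 2)) * expectation (?Z n)" using factor nn by (rule mult_right_mono)
    also have "\<dots> \<le> exp (- (s * \<eta> / 2)) * (exp (- (s * \<eta> / 2)) ^ n * exp (s * Fb))"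
      using Suc by (intro mult_left_mono) auto
    finally show ?case by (simp add: mult.assoc)
  qed
  define A where "A n = {\<omega>\<in>space M. - (\<eta> / 4) * real n < (\<Sum>i<n. block g m (wait \<omega>) (mode \<omega>) i)}" for n
  have [measurable]: "(\<lambda>\<omega>. block g m (wait \<omega>) (mode \<omega>) i) \<in> borel_measurable M" for i
    using measurable_compose[OF measurable_Pair[OF mode_measurable wait_measurable] block_measurable] by simp
  have A [measurable]: "A n \<in> sets M" for n unfolding A_def by measurable
  \<comment> \<open>Moments decay at rate \<open>s * \<eta> / 2\<close> per block and the threshold
    \<open>- \<eta> / 4\<close> gives back \<open>s * \<eta> / 4\<close>, so this rate is left in
    the Markov inequality.\<close>
  define q where "q = exp (- (s * \<eta> / 4))"
  have q: "0 < q" "q < 1" using s \<eta> by (auto simp: q_def)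
  have PA: "prob (A n) \<le> exp (2 * s * Fb) * q ^ n" for n
  proof -
    \<comment> \<open>A lower bound for \<open>block_exp\<close> on \<open>A n\<close>, with the
      corrector at its worst value \<open>- Fb\<close>.\<close>
    define a where "a = exp (s * (- (\<eta> / 4) * real n - Fb))"
    have "expectation (\<lambda>\<omega>. a * indicator (A n) \<omega>) \<le> expectation (?Z n)"
    proof (rule integral_mono[OF _ Z_int])
      show "integrable M (\<lambda>\<omega>. a * indicator (A n) \<omega>)" by (simp add: emeasure_eq_measure)
      fix \<omega>
      show "a * indicator (A n) \<omega> \<le> ?Z n \<omega>"
      proof (cases "\<omega> \<in> A n")
        case True
        then have "- (\<eta> / 4) * real n - Fb \<le> (\<Sum>i<n. block g m (wait \<omega>) (mode \<omega>) i) + f (mode \<omega> (obs_at (wait \<omega>) n))"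
          using f[of "mode \<omega> (obs_at (wait \<omega>) n)"] unfolding A_def mem_Collect_eq by linarith
        then show ?thesis using True s(1) by (simp add: a_def block_exp_def mult_left_mono)
      qed (simp add: block_exp_def)
    qed
    then have "a * prob (A n) \<le> exp (- (s * \<eta> / 2)) ^ n * exp (s * Fb)"
      using E_bd[of n] by (simp add: emeasure_eq_measure)
    then have "prob (A n) \<le> exp (- (s * \<eta> / 2)) ^ n * exp (s * Fb) / a"
      by (simp add: a_def field_simps)
    also have "\<dots> = exp (2 * s * Fb) * q ^ n"
      by (simp add: a_def q_def exp_of_nat_mult[symmetric] flip: exp_diff exp_add) (simp add: algebra_simps)
    finally show ?thesis .
  qed
  have "summable (\<lambda>n. prob (A n))"
  proof (rule summable_comparison_test'[of "\<lambda>n. exp (2 * s * Fb) * q ^ n" 0])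
    show "summable (\<lambda>n. exp (2 * s * Fb) * q ^ n)" using q by (intro summable_mult summable_geometric) auto
  qed (use PA in auto)
  then have "AE \<omega> in M. eventually (\<lambda>n. \<omega> \<in> space M - A n) sequentially"
    by (intro borel_cantelli_AE1) (auto simp: emeasure_eq_measure)
  then show ?thesis
    by eventually_elim (auto simp: A_def not_less elim: eventually_mono)
qed

end

section \<open>Divergence of the accumulated logarithmic gain\<close>

definition obs_count :: "(nat \<Rightarrow> nat) \<Rightarrow> nat \<Rightarrow> nat" where
  "obs_count u k = card {i. 1 \<le> i \<and> obs_at u i \<le> k}"

lemma obs_count_eqI:
  assumes n: "obs_at u n \<le> k" "k < obs_at u (Suc n)"
  shows "obs_count u k = n"
proof -
  have le_iff: "obs_at u i \<le> k \<longleftrightarrow> i \<le> n" for i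
    using obs_at_mono[of i n u] obs_at_mono[of "Suc n" i u] n by (cases "i \<le> n") auto
  have "{i. 1 \<le> i \<and> obs_at u i \<le> k} = {1..n}" unfolding le_iff by auto
  then show ?thesis by (simp add: obs_count_def)
qed

lemma obs_at_ge: "(\<And>i. 0 < u i) \<Longrightarrow> n \<le> obs_at u n"
proof (induction n)
  case (Suc n)
  then have "n \<le> obs_at u n" "0 < u n" by auto
  then show ?case by (simp add: obs_at_Suc)
qed simp

lemma obs_count_bounds:
  assumes pos: "\<And>i. 0 < u i"
  shows "obs_at u (obs_count u k) \<le> k" "k < obs_at u (Suc (obs_count u k))"
proof -
  define n where "n = (LEAST n. k < obs_at u (Suc n))"
  have "k < obs_at u (Suc k)" using obs_at_ge[of u "Suc k", OF pos] by simp
  then have 1: "k < obs_at u (Suc n)" unfolding n_def by (rule LeastI)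
  have 2: "obs_at u n \<le> k"
  proof (cases n)
    case (Suc n')
    then have "\<not> k < obs_at u (Suc n')" unfolding n_def by (metis Suc n_def lessI not_less_Least)
    then show ?thesis using Suc by simp
  qed (simp add: obs_at_def)
  show "obs_at u (obs_count u k) \<le> k" "k < obs_at u (Suc (obs_count u k))"
    using 1 2 obs_count_eqI[OF 2 1] by simp_all
qed

lemma filterlim_obs_count:
  assumes pos: "\<And>i. 0 < u i"
  shows "filterlim (obs_count u) at_top sequentially"
  unfolding filterlim_at_top eventually_sequentially
proof (intro allI)
  fix Z :: nat
  have "Z \<le> obs_count u k" if "obs_at u Z \<le> k" for k
  proof (rule ccontr)
    assume "\<not> Z \<le> obs_count u k"
    then have "obs_at u (Suc (obs_count u k)) \<le> obs_at u Z" by (intro obs_at_mono) simp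
    then show False using that obs_count_bounds(2)[of u k, OF pos] by simp
  qed
  then show "\<exists>N. \<forall>k\<ge>N. Z \<le> obs_count u k" by blast
qed

definition reward :: "('i \<Rightarrow> 'i \<Rightarrow> real) \<Rightarrow> (nat \<Rightarrow> nat) \<Rightarrow> (nat \<Rightarrow> 'i) \<Rightarrow> nat \<Rightarrow> real" where
  "reward g u \<rho> k = (\<Sum>t<k. g (\<rho> t) (\<rho> (obs_at u (obs_count u t))))"

lemma reward_within_block:
  assumes l: "l \<le> u n"
  shows "reward g u \<rho> (obs_at u n + l)
    = reward g u \<rho> (obs_at u n) + (\<Sum>t<l. g (\<rho> (obs_at u n + t)) (\<rho> (obs_at u n)))"
  using l
proof (induction l)
  case (Suc l)
  have "obs_count u (obs_at u n + l) = n"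
    using Suc.prems by (intro obs_count_eqI) (auto simp: obs_at_Suc)
  then show ?case using Suc by (simp add: reward_def)
qed simp

text \<open>\<open>block\<close> keeps the first \<open>m\<close> steps of each block; each of the
  remaining \<open>u i - m\<close> steps costs at most \<open>G\<close>.\<close>

lemma reward_block_le:
  assumes g: "\<And>i j. \<bar>g j i\<bar> \<le> G"
  shows "reward g u \<rho> (obs_at u n) \<le> (\<Sum>i<n. block g m u \<rho> i) + G * (\<Sum>i<n. real (u i - m))"
proof (induction n)
  case (Suc n)
  let ?h = "\<lambda>t. g (\<rho> (obs_at u n + t)) (\<rho> (obs_at u n))"
  have "(\<Sum>t<u n. ?h t) = (\<Sum>t<min m (u n). ?h t) + (\<Sum>t\<in>{min m (u n)..<u n}. ?h t)"
    by (subst sum.union_disjoint[symmetric]) (auto intro!: sum.cong)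
  also have "(\<Sum>t<min m (u n). ?h t) = block g m u \<rho> n"
    unfolding block_def by (subst sum.inter_filter[symmetric]) (auto intro!: sum.cong)
  also have "(\<Sum>t\<in>{min m (u n)..<u n}. ?h t) \<le> (\<Sum>t\<in>{min m (u n)..<u n}. G)"
    using g by (intro sum_mono) (auto simp: abs_le_iff)
  also have "\<dots> = G * real (u n - m)" by (cases "m \<le> u n") (auto simp: min_def)
  finally show ?case
    using Suc reward_within_block[of "u n" u n g \<rho>] by (simp add: obs_at_Suc algebra_simps)
qed (simp add: reward_def obs_at_def)

text \<open>The block containing \<open>k\<close> may be incomplete. Each of its steps so far is
  charged \<open>G\<close>, and their number is at most \<open>m + (u (N k) - m)\<close>; this
  explains the extra \<open>G * real m\<close> and the range up to \<open>Suc (N k)\<close>.\<close>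

lemma reward_le:
  assumes pos: "\<And>i. 0 < u i" and g: "\<And>i j. \<bar>g j i\<bar> \<le> G"
  defines "N \<equiv> obs_count u"
  shows "reward g u \<rho> k \<le> (\<Sum>i<N k. block g m u \<rho> i) + G * (\<Sum>i<Suc (N k). real (u i - m)) + G * real m"
proof -
  have G: "0 \<le> G" using g abs_ge_zero order_trans by blast
  let ?n = "N k"
  define l where "l = k - obs_at u ?n"
  have k: "k = obs_at u ?n + l" "l \<le> u ?n"
    using obs_count_bounds[of u k, OF pos] by (auto simp: l_def N_def obs_at_Suc)
  have "reward g u \<rho> k = reward g u \<rho> (obs_at u ?n) + (\<Sum>t<l. g (\<rho> (obs_at u ?n + t)) (\<rho> (obs_at u ?n)))"
    using reward_within_block[of l u ?n g \<rho>, OF k(2)] k(1) by simp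
  also have "(\<Sum>t<l. g (\<rho> (obs_at u ?n + t)) (\<rho> (obs_at u ?n))) \<le> (\<Sum>t<l. G)"
    using g by (intro sum_mono) (auto simp: abs_le_iff)
  also have "\<dots> \<le> G * (real m + real (u ?n - m))"
    using k(2) mult_left_mono[OF _ G, of "real l" "real m + real (u ?n - m)"] by (simp add: mult.commute)
  finally show ?thesis
    using reward_block_le[of g G u \<rho> ?n m, OF g] by (simp add: algebra_simps)
qed

lemma linear_decay_at_bot:
  assumes "filterlim N at_top sequentially" "0 < c"
    and "eventually (\<lambda>k. S k \<le> d - c * real (N k)) sequentially"
  shows "filterlim S at_bot sequentially"
proof -
  have "filterlim (\<lambda>k. real (N k)) at_top sequentially"
    by (rule filterlim_compose[OF filterlim_real_sequentially assms(1)])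
  then have "filterlim (\<lambda>k. c * real (N k)) at_top sequentially"
    by (rule filterlim_tendsto_pos_mult_at_top[OF tendsto_const assms(2)])
  then have "filterlim (\<lambda>k. - d + c * real (N k)) at_top sequentially"
    by (rule filterlim_tendsto_add_at_top[OF tendsto_const])
  then have lim: "eventually (\<lambda>k. - Z \<le> - d + c * real (N k)) sequentially" for Z
    by (simp add: filterlim_at_top)
  show ?thesis unfolding filterlim_at_bot
  proof
    show "eventually (\<lambda>k. S k \<le> Z) sequentially" for Z
      using lim[of Z] assms(3) by eventually_elim linarith
  qed
qed

context rewarded_chain
begin

text \<open>The mean gain \<open>l\<close> steps after an observation whose mode has the invariant
  law.\<close>

definition stat_reward :: "nat \<Rightarrow> real" where
  "stat_reward l = (\<Sum>i\<in>UNIV. \<pi> i * mop p l (\<lambda>j. g j i) i)"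

lemma abs_stat_reward: "\<bar>stat_reward l\<bar> \<le> G"
proof -
  have "\<bar>stat_reward l\<bar> \<le> (\<Sum>i\<in>UNIV. \<pi> i * G)"
    unfolding stat_reward_def
    using invar abs_mop_le[OF stoch] g_bound
    by (intro order_trans[OF sum_abs] sum_mono) (auto simp: abs_mult invariant_dist_def intro!: mult_left_mono)
  then show ?thesis using invar by (simp add: invariant_dist_def flip: sum_distrib_right)
qed

text \<open>The stationary means of the truncated blocks converge, by dominated convergence, to the
  mean \<open>E < 0\<close> of the full block, so they eventually lie below \<open>E / 2\<close>;
  Poisson's equation makes such a mean the drift from every mode. Only the corrector depends on
  \<open>m\<close>.\<close>

lemma negative_drift:
  assumes neg: "(\<Sum>t. mu t * (\<Sum>l<t. stat_reward l)) < 0"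
  obtains \<eta> where "0 < \<eta>"
    "eventually (\<lambda>m. \<exists>f. \<forall>y. expectation (\<lambda>\<omega>. corrected_drift m f (wait \<omega> 0) y) \<le> - \<eta>) sequentially"
proof -
  define T where "T m t = (\<Sum>l<m. if l < t then stat_reward l else 0)" for m t
  have T_eq: "T m t = (\<Sum>l<min m t. stat_reward l)" for m t
    unfolding T_def by (subst sum.inter_filter[symmetric]) (auto intro!: sum.cong)
  have sum_bd: "\<bar>\<Sum>l<n. stat_reward l\<bar> \<le> G * real n" for n
  proof -
    have "\<bar>\<Sum>l<n. stat_reward l\<bar> \<le> (\<Sum>l<n. G)"
      by (intro order_trans[OF sum_abs] sum_mono abs_stat_reward)
    then show ?thesis by (simp add: mult.commute)
  qed
  have T_bd: "\<bar>T m t\<bar> \<le> G * real t" for m t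
  proof -
    have "G * real (min m t) \<le> G * real t" using G_nonneg by (intro mult_left_mono) auto
    then show ?thesis using sum_bd[of "min m t"] by (simp add: T_eq)
  qed
  define E where "E = expectation (\<lambda>\<omega>. \<Sum>l<wait \<omega> 0. stat_reward l)"
  have "E = (\<Sum>t. mu t * (\<Sum>l<t. stat_reward l))"
    unfolding E_def by (rule wait_linear_growth(2)[OF sum_bd])
  then have E: "E < 0" using neg by simp
  have "(\<lambda>m. T m t) \<longlonglongrightarrow> (\<Sum>l<t. stat_reward l)" for t
    by (rule tendsto_eventually) (auto simp: T_eq min_def intro: eventually_mono[OF eventually_ge_at_top[of t]])
  then have "(\<lambda>m. expectation (\<lambda>\<omega>. T m (wait \<omega> 0))) \<longlonglongrightarrow> E"
    unfolding E_def by (intro wait_fun_dominated[OF T_bd])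
  then have ev: "eventually (\<lambda>m. expectation (\<lambda>\<omega>. T m (wait \<omega> 0)) < E / 2) sequentially"
    using E by (intro order_tendstoD) auto
  have "\<exists>f. \<forall>y. expectation (\<lambda>\<omega>. corrected_drift m f (wait \<omega> 0) y) = expectation (\<lambda>\<omega>. T m (wait \<omega> 0))" for m
  proof -
    define H where "H y t = (\<Sum>l<m. if l < t then mop p l (\<lambda>j. g j y) y else 0)" for y t
    have H_int: "integrable M (\<lambda>\<omega>. H y (wait \<omega> 0))" for y
    proof (rule integrable_const_bound[of _ "\<Sum>l<m. G"])
      have "\<bar>H y t\<bar> \<le> (\<Sum>l<m. G)" for t
        unfolding H_def using abs_mop_le[OF stoch, of "\<lambda>j. g j y" G] g_bound G_nonneg
        by (intro order_trans[OF sum_abs] sum_mono) auto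
      then show "AE \<omega> in M. norm (H y (wait \<omega> 0)) \<le> (\<Sum>l<m. G)" by auto
    qed measurable
    obtain f where f: "\<And>y. expectation (\<lambda>\<omega>. H y (wait \<omega> 0)) + expectation (\<lambda>\<omega>. mop p (wait \<omega> 0) f y) - f y
        = (\<Sum>i\<in>UNIV. \<pi> i * expectation (\<lambda>\<omega>. H i (wait \<omega> 0)))"
      using poisson_equation[of "\<lambda>y. expectation (\<lambda>\<omega>. H y (wait \<omega> 0))"] by blast
    have "(\<Sum>i\<in>UNIV. \<pi> i * H i t) = T m t" for t
    proof -
      have "(\<Sum>i\<in>UNIV. \<pi> i * H i t) = (\<Sum>i\<in>UNIV. \<Sum>l<m. if l < t then \<pi> i * mop p l (\<lambda>j. g j i) i else 0)"
        by (simp add: H_def sum_distrib_left if_distrib cong: if_cong)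
      also have "\<dots> = (\<Sum>l<m. \<Sum>i\<in>UNIV. if l < t then \<pi> i * mop p l (\<lambda>j. g j i) i else 0)"
        by (rule sum.swap)
      also have "\<dots> = T m t" unfolding T_def stat_reward_def by (intro sum.cong) auto
      finally show ?thesis .
    qed
    then have "expectation (\<lambda>\<omega>. T m (wait \<omega> 0)) = expectation (\<lambda>\<omega>. \<Sum>i\<in>UNIV. \<pi> i * H i (wait \<omega> 0))"
      by simp
    also have "\<dots> = (\<Sum>i\<in>UNIV. \<pi> i * expectation (\<lambda>\<omega>. H i (wait \<omega> 0)))"
      using H_int by simp
    finally have "(\<Sum>i\<in>UNIV. \<pi> i * expectation (\<lambda>\<omega>. H i (wait \<omega> 0))) = expectation (\<lambda>\<omega>. T m (wait \<omega> 0))" ..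
    moreover have "expectation (\<lambda>\<omega>. corrected_drift m f (wait \<omega> 0) y)
        = expectation (\<lambda>\<omega>. H y (wait \<omega> 0)) + expectation (\<lambda>\<omega>. mop p (wait \<omega> 0) f y) - f y" for y
      using H_int[of y] by (simp add: corrected_drift_def H_def[symmetric] prob_space)
    ultimately show ?thesis using f by auto
  qed
  then have "eventually (\<lambda>m. \<exists>f. \<forall>y. expectation (\<lambda>\<omega>. corrected_drift m f (wait \<omega> 0) y) \<le> - (- E / 2)) sequentially"
    using ev by (auto elim!: eventually_mono) (metis less_imp_le)
  then show ?thesis using that[of "- E / 2"] E by simp
qed

lemma reward_at_bot:
  assumes neg: "(\<Sum>t. mu t * (\<Sum>l<t. stat_reward l)) < 0"
  shows "AE \<omega> in M. filterlim (reward g (wait \<omega>) (mode \<omega>)) at_bot sequentially"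
proof -
  obtain \<eta> where \<eta>: "0 < \<eta>" and drift: "eventually (\<lambda>m. \<exists>f. \<forall>y. expectation (\<lambda>\<omega>. corrected_drift m f (wait \<omega> 0) y) \<le> - \<eta>) sequentially"
    using negative_drift[OF neg] .
  \<comment> \<open>Tail sums enter with the factor \<open>G\<close>, so this choice lets them use
    at most \<open>\<eta> / 8\<close> per block; adding 1 avoids a zero denominator.\<close>
  define e where "e = \<eta> / (8 * (G + 1))"
  have e: "0 < e" "G * e \<le> \<eta> / 8" using \<eta> G_nonneg by (auto simp: e_def field_simps)
  define T where "T m = {\<omega>\<in>space M. \<exists>n. e * real n < (\<Sum>i<n. real (wait \<omega> i - m))}" for m
  have T [measurable]: "T m \<in> sets M" for m unfolding T_def by measurable
  have T_prob: "prob (T m) \<le> expectation (\<lambda>\<omega>. real (wait \<omega> 0 - m)) / e" for m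
    unfolding T_def
    by (rule maximal_inequality[OF _ wait_linear_growth(1)[of "\<lambda>t. real (t - m)" 1] e(1)]) auto
  have good: "AE \<omega> in M. \<omega> \<notin> T m \<longrightarrow> filterlim (reward g (wait \<omega>) (mode \<omega>)) at_bot sequentially"
    if f: "\<And>y. expectation (\<lambda>\<omega>. corrected_drift m f (wait \<omega> 0) y) \<le> - \<eta>" for m f
  proof -
    have "AE \<omega> in M. eventually (\<lambda>n. (\<Sum>i<n. block g m (wait \<omega>) (mode \<omega>) i) \<le> - (\<eta> / 4) * real n) sequentially"
      by (rule blocks_drift[OF abs_le_sum_abs \<eta> f])
    then show ?thesis using wait_pos AE_space
    proof eventually_elim
      case (elim \<omega>)
      show ?case
      proof
        assume "\<omega> \<notin> T m"
        then have tail: "(\<Sum>i<n. real (wait \<omega> i - m)) \<le> e * real n" for n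
          using elim(3) by (auto simp: T_def not_less)
        let ?N = "obs_count (wait \<omega>)"
        have N: "filterlim ?N at_top sequentially" using elim(2) by (intro filterlim_obs_count) auto
        have "eventually (\<lambda>k. (\<Sum>i<?N k. block g m (wait \<omega>) (mode \<omega>) i) \<le> - (\<eta> / 4) * real (?N k)) sequentially"
          using filterlim_iff[THEN iffD1, OF N, rule_format, OF elim(1)] .
        \<comment> \<open>The constant collects \<open>G * real m\<close> from the incomplete block
          and one \<open>\<eta> / 8\<close> from the tail sum running one index further.\<close>
        then have "eventually (\<lambda>k. reward g (wait \<omega>) (mode \<omega>) k \<le> (\<eta> / 8 + G * real m) - \<eta> / 8 * real (?N k)) sequentially"
        proof eventually_elim
          case (elim k)
          have "reward g (wait \<omega>) (mode \<omega>) k \<le> (\<Sum>i<?N k. block g m (wait \<omega>) (mode \<omega>) i)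
              + G * (\<Sum>i<Suc (?N k). real (wait \<omega> i - m)) + G * real m"
            using \<open>\<forall>i. 0 < wait \<omega> i\<close> by (intro reward_le g_bound) auto
          also have "G * (\<Sum>i<Suc (?N k). real (wait \<omega> i - m)) \<le> G * (e * real (Suc (?N k)))"
            by (rule mult_left_mono[OF tail G_nonneg])
          also have "\<dots> = G * e * real (Suc (?N k))" by simp
          also have "\<dots> \<le> \<eta> / 8 * real (Suc (?N k))"
            using e(2) by (intro mult_right_mono) auto
          finally show ?case using elim by (simp add: algebra_simps)
        qed
        then show "filterlim (reward g (wait \<omega>) (mode \<omega>)) at_bot sequentially"
          using \<eta> by (intro linear_decay_at_bot[OF N, of "\<eta> / 8"]) auto
      qed
    qed
  qed
  \<comment> \<open>\<open>T m\<close> need not be null for any single \<open>m\<close>, but the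
    limit claimed off \<open>T m\<close> does not mention \<open>m\<close>. Countably many cut-offs
    therefore leave only the intersection of the exceptional events, which is null.\<close>
  have "\<exists>m. prob (T m) < 1 / real (Suc j) \<and> (AE \<omega> in M. \<omega> \<notin> T m \<longrightarrow> filterlim (reward g (wait \<omega>) (mode \<omega>)) at_bot sequentially)" for j
  proof -
    have "(\<lambda>m. expectation (\<lambda>\<omega>. real (wait \<omega> 0 - m)) / e) \<longlonglongrightarrow> 0 / e"
      using e(1) by (intro tendsto_divide tail_mean_vanishes tendsto_const) auto
    then have "eventually (\<lambda>m. expectation (\<lambda>\<omega>. real (wait \<omega> 0 - m)) / e < 1 / real (Suc j)) sequentially"
      by (rule order_tendstoD) simp
    with drift obtain m f where "expectation (\<lambda>\<omega>. real (wait \<omega> 0 - m)) / e < 1 / real (Suc j)"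
      and "\<And>y. expectation (\<lambda>\<omega>. corrected_drift m f (wait \<omega> 0) y) \<le> - \<eta>"
      using eventually_happens'[OF sequentially_bot eventually_conj] by blast
    then show ?thesis using good[of m f] T_prob[of m] by (intro exI[of _ m]) auto
  qed
  then have "\<forall>j. \<exists>m. prob (T m) < 1 / real (Suc j) \<and> (AE \<omega> in M. \<omega> \<notin> T m \<longrightarrow> filterlim (reward g (wait \<omega>) (mode \<omega>)) at_bot sequentially)"
    by blast
  from choice[OF this] obtain m where m: "\<And>j. prob (T (m j)) < 1 / real (Suc j)"
    "\<And>j. AE \<omega> in M. \<omega> \<notin> T (m j) \<longrightarrow> filterlim (reward g (wait \<omega>) (mode \<omega>)) at_bot sequentially"
    by blast
  have "prob (\<Inter>j. T (m j)) \<le> 1 / real (Suc j)" for j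
  proof -
    have "prob (\<Inter>j. T (m j)) \<le> prob (T (m j))" by (rule finite_measure_mono) auto
    then show ?thesis using m(1)[of j] by linarith
  qed
  then have "prob (\<Inter>j. T (m j)) \<le> 0"
    by (intro LIMSEQ_le_const[OF LIMSEQ_inverse_real_of_nat]) (auto simp: inverse_eq_divide)
  then have "AE \<omega> in M. \<omega> \<notin> (\<Inter>j. T (m j))"
    by (intro AE_not_in) (auto simp: null_sets_def emeasure_eq_measure measure_le_0_iff)
  moreover have "AE \<omega> in M. \<forall>j. \<omega> \<notin> T (m j) \<longrightarrow> filterlim (reward g (wait \<omega>) (mode \<omega>)) at_bot sequentially"
    unfolding AE_all_countable using m(2) by blast
  ultimately show ?thesis by eventually_elim auto
qed

end

section \<open>The closed loop\<close>

context sampled_chain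
begin

lemma obs_time_eq: "obs_time tau i \<omega> = obs_at (wait \<omega>) i"
  using sum.atLeast1_atMost_eq[of "\<lambda>j. tau j \<omega>" i] by (simp add: obs_time_def obs_at_def wait_def)

lemma sampled_mode_eq: "sampled_mode r tau k \<omega> = mode \<omega> (obs_at (wait \<omega>) (obs_count (wait \<omega>) k))"
  by (simp add: sampled_mode_def count_obs_def obs_count_def obs_time_eq mode_def)

lemma sampled_mode_measurable [measurable]: "sampled_mode r tau k \<in> measurable M (count_space UNIV)"
proof -
  have obs [measurable]: "(\<lambda>\<omega>. obs_at (wait \<omega>) n) \<in> measurable M (count_space UNIV)" for n
    using measurable_compose[OF measurable_Pair[OF mode_measurable wait_measurable] obs_at_measurable[of n]] by simp
  have cnt: "(\<lambda>\<omega>. obs_count (wait \<omega>) k) \<in> measurable M (count_space UNIV)"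
    unfolding obs_count_def by measurable
  have mode_obs: "(\<lambda>\<omega>. mode \<omega> (obs_at (wait \<omega>) n)) \<in> measurable M (count_space UNIV)" for n
    by (rule measurable_compose_countable[where f = "\<lambda>t \<omega>. mode \<omega> t", OF _ obs]) measurable
  have "(\<lambda>\<omega>. mode \<omega> (obs_at (wait \<omega>) (obs_count (wait \<omega>) k))) \<in> measurable M (count_space UNIV)"
    by (rule measurable_compose_countable[where f = "\<lambda>n \<omega>. mode \<omega> (obs_at (wait \<omega>) n)", OF mode_obs cnt])
  then show ?thesis by (simp add: sampled_mode_eq[abs_def])
qed

lemma closed_loop_measurable [measurable]: "closed_loop A B K r tau x0 k \<in> borel_measurable M"
proof (induction k)
  case 0
  have "closed_loop A B K r tau x0 0 = (\<lambda>_. x0)" by auto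
  then show ?case by simp
next
  case (Suc k)
  have lin: "(\<lambda>\<omega>. A i *v closed_loop A B K r tau x0 k \<omega> + B i *v (K j *v closed_loop A B K r tau x0 k \<omega>))
      \<in> borel_measurable M" for i j
  proof -
    have "(*v) (A i + B i ** K j) \<in> borel_measurable borel"
      by (intro borel_measurable_continuous_onI linear_continuous_on matrix_vector_mul_bounded_linear)
    from measurable_compose[OF Suc this] show ?thesis
      by (simp add: matrix_vector_mult_add_rdistrib matrix_vector_mul_assoc)
  qed
  have rk: "r k \<in> measurable M (count_space UNIV)" using chain by (simp add: markov_chain_def)
  have "closed_loop A B K r tau x0 (Suc k) = (\<lambda>\<omega>. A (r k \<omega>) *v closed_loop A B K r tau x0 k \<omega>
      + B (r k \<omega>) *v (K (sampled_mode r tau k \<omega>) *v closed_loop A B K r tau x0 k \<omega>))" by auto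
  moreover have "(\<lambda>\<omega>. A i *v closed_loop A B K r tau x0 k \<omega>
      + B i *v (K (sampled_mode r tau k \<omega>) *v closed_loop A B K r tau x0 k \<omega>)) \<in> borel_measurable M" for i
    by (rule measurable_compose_countable[OF lin sampled_mode_measurable])
  then have "(\<lambda>\<omega>. A (r k \<omega>) *v closed_loop A B K r tau x0 k \<omega>
      + B (r k \<omega>) *v (K (sampled_mode r tau k \<omega>) *v closed_loop A B K r tau x0 k \<omega>)) \<in> borel_measurable M"
    by (rule measurable_compose_countable[OF _ rk])
  ultimately show ?case by simp
qed

lemma reward_measurable [measurable]: "(\<lambda>\<omega>. reward h (wait \<omega>) (mode \<omega>) k) \<in> borel_measurable M"
proof -
  have "(\<lambda>\<omega>. h (mode \<omega> t) (sampled_mode r tau t \<omega>)) \<in> borel_measurable M" for t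
    by (rule measurable_fun2[OF mode_measurable_component sampled_mode_measurable]) auto
  then show ?thesis unfolding reward_def sampled_mode_eq[symmetric] by measurable
qed

end

section \<open>From divergence of the exponent to stability\<close>

text \<open>The events \<open>Bad j\<close> that some \<open>S k\<close> exceeds \<open>j\<close>
  decrease to a null event, as a sequence tending to minus infinity is bounded above. Off
  \<open>Bad j\<close> the state is amplified by a bounded factor at all times. Since
  \<open>S\<close> does not involve \<open>x0\<close>, one \<open>\<delta>\<close> serves every
  initial state.\<close>

lemma (in prob_space) as_asymp_stable_of_reward:
  fixes x :: "real^'n \<Rightarrow> nat \<Rightarrow> 'a \<Rightarrow> real^'n" and S :: "nat \<Rightarrow> 'a \<Rightarrow> real"
  assumes x [measurable]: "\<And>x0 k. x x0 k \<in> borel_measurable M" and S [measurable]: "\<And>k. S k \<in> borel_measurable M"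
    and c: "0 < c" and le: "\<And>x0 k \<omega>. (norm (x x0 k \<omega>))\<^sup>2 \<le> c * exp (S k \<omega>) * (norm x0)\<^sup>2"
    and lim: "AE \<omega> in M. filterlim (\<lambda>k. S k \<omega>) at_bot sequentially"
  shows "as_asymp_stable M x"
  unfolding as_asymp_stable_def as_stable_def
proof (intro conjI allI impI)
  fix x0
  have "AE \<omega> in M. (\<lambda>k. norm (x x0 k \<omega>)) \<longlonglongrightarrow> 0"
    using lim
  proof eventually_elim
    case (elim \<omega>)
    have "(\<lambda>k. exp (S k \<omega>)) \<longlonglongrightarrow> 0"
      by (rule filterlim_compose[OF exp_at_bot elim])
    then have "(\<lambda>k. c * exp (S k \<omega>) * (norm x0)\<^sup>2) \<longlonglongrightarrow> 0"
      using tendsto_mult_left[of _ 0 sequentially c] tendsto_mult_right[of _ 0 sequentially "(norm x0)\<^sup>2"] by fastforce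
    then have "(\<lambda>k. (norm (x x0 k \<omega>))\<^sup>2) \<longlonglongrightarrow> 0"
      by (rule real_tendsto_sandwich[OF _ _ tendsto_const, rotated 2]) (auto simp: le)
    from tendsto_real_sqrt[OF this] show ?case by simp
  qed
  \<comment> \<open>Countable quantifiers make the convergence event visibly measurable.\<close>
  moreover have lim_iff: "(\<lambda>k. norm (x x0 k \<omega>)) \<longlonglongrightarrow> 0 \<longleftrightarrow>
      (\<forall>j. \<exists>N. \<forall>k\<ge>N. norm (x x0 k \<omega>) < inverse (real (Suc j)))" for \<omega>
  proof
    assume "(\<lambda>k. norm (x x0 k \<omega>)) \<longlonglongrightarrow> 0"
    from order_tendstoD(2)[OF this] show "\<forall>j. \<exists>N. \<forall>k\<ge>N. norm (x x0 k \<omega>) < inverse (real (Suc j))"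
      by (simp add: eventually_sequentially)
  next
    assume R: "\<forall>j. \<exists>N. \<forall>k\<ge>N. norm (x x0 k \<omega>) < inverse (real (Suc j))"
    show "(\<lambda>k. norm (x x0 k \<omega>)) \<longlonglongrightarrow> 0"
    proof (rule LIMSEQ_I)
      fix e :: real assume "0 < e"
      then obtain j where j: "inverse (real (Suc j)) < e" using reals_Archimedean by blast
      obtain N where N: "\<And>k. k \<ge> N \<Longrightarrow> norm (x x0 k \<omega>) < inverse (real (Suc j))" using R by blast
      have "norm (norm (x x0 k \<omega>) - 0) < e" if "k \<ge> N" for k
        using N[OF that] j by simp
      then show "\<exists>N. \<forall>k\<ge>N. norm (norm (x x0 k \<omega>) - 0) < e" by blast
    qed
  qed
  have "{\<omega>\<in>space M. (\<lambda>k. norm (x x0 k \<omega>)) \<longlonglongrightarrow> 0} \<in> sets M"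
    unfolding lim_iff by measurable
  ultimately show "prob {\<omega>\<in>space M. (\<lambda>k. norm (x x0 k \<omega>)) \<longlonglongrightarrow> 0} = 1"
    by (simp only: prob_Collect_eq_1)
next
  fix \<epsilon> \<rho> :: real assume pos: "0 < \<epsilon>" "0 < \<rho>"
  define Bad where "Bad j = {\<omega>\<in>space M. \<exists>k. real j < S k \<omega>}" for j
  have Bad [measurable]: "Bad j \<in> sets M" for j unfolding Bad_def by measurable
  have "AE \<omega> in M. \<omega> \<notin> (\<Inter>j. Bad j)"
    using lim
  proof eventually_elim
    case (elim \<omega>)
    then obtain N where N: "\<And>k. k \<ge> N \<Longrightarrow> S k \<omega> \<le> 0"
      unfolding filterlim_at_bot eventually_sequentially by blast
    obtain j :: nat where j: "(\<Sum>k<N. \<bar>S k \<omega>\<bar>) \<le> real j" using real_arch_simple by blast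
    have "S k \<omega> \<le> real j" for k
    proof (cases "k < N")
      case True
      then have "\<bar>S k \<omega>\<bar> \<le> (\<Sum>k<N. \<bar>S k \<omega>\<bar>)" by (intro member_le_sum) auto
      then show ?thesis using j by linarith
    next
      case False
      then show ?thesis using N[of k] by (meson not_less of_nat_0_le_iff order_trans)
    qed
    then have "\<omega> \<notin> Bad j" by (auto simp: Bad_def not_less)
    then show ?case by blast
  qed
  then have "prob (\<Inter>j. Bad j) = 0"
    by (subst (asm) AE_iff_null_sets[symmetric]) (auto simp: measure_eq_0_null_sets)
  moreover have "(\<lambda>j. prob (Bad j)) \<longlonglongrightarrow> prob (\<Inter>j. Bad j)"
  proof (rule finite_Lim_measure_decseq)
    show "decseq Bad" by (auto simp: decseq_def Bad_def) (meson of_nat_mono order_le_less_trans)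
  qed auto
  ultimately have "eventually (\<lambda>j. prob (Bad j) < \<rho>) sequentially"
    using pos by (auto intro: order_tendstoD)
  then obtain j where j: "prob (Bad j) < \<rho>" by (auto simp: eventually_sequentially)
  \<comment> \<open>The largest amplification of the norm possible off \<open>Bad j\<close>; hence
    \<open>\<delta> = \<epsilon> / q\<close>.\<close>
  define q where "q = sqrt (c * exp (real j))"
  have q: "0 < q" using c by (simp add: q_def)
  show "\<exists>\<delta>>0. \<forall>x0. norm x0 < \<delta> \<longrightarrow> prob {\<omega>\<in>space M. (SUP k. ereal (norm (x x0 k \<omega>))) > ereal \<epsilon>} < \<rho>"
  proof (intro exI[of _ "\<epsilon> / q"] conjI allI impI)
    fix x0 :: "real^'n" assume x0: "norm x0 < \<epsilon> / q"
    have "{\<omega>\<in>space M. (SUP k. ereal (norm (x x0 k \<omega>))) > ereal \<epsilon>} \<subseteq> Bad j"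
    proof safe
      fix \<omega> assume \<omega>: "\<omega> \<in> space M" "(SUP k. ereal (norm (x x0 k \<omega>))) > ereal \<epsilon>"
      then obtain k where k: "\<epsilon> < norm (x x0 k \<omega>)" by (auto simp: less_SUP_iff)
      have "(q * norm x0)\<^sup>2 \<le> \<epsilon>\<^sup>2"
        using x0 q by (intro power_mono) (auto simp: field_simps)
      then have "c * exp (real j) * (norm x0)\<^sup>2 \<le> \<epsilon>\<^sup>2" using c by (simp add: q_def power_mult_distrib)
      also have "\<dots> < (norm (x x0 k \<omega>))\<^sup>2" using k pos by (intro power_strict_mono) auto
      also have "\<dots> \<le> c * exp (S k \<omega>) * (norm x0)\<^sup>2" by (rule le)
      finally have "exp (real j) < exp (S k \<omega>)"
        using c by (metis mult_le_cancel_left_pos mult_right_mono not_less zero_le_power2)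
      then show "\<omega> \<in> Bad j" using \<omega> by (auto simp: Bad_def)
    qed
    then have "prob {\<omega>\<in>space M. (SUP k. ereal (norm (x x0 k \<omega>))) > ereal \<epsilon>} \<le> prob (Bad j)"
      by (rule finite_measure_mono) simp
    then show "prob {\<omega>\<in>space M. (SUP k. ereal (norm (x x0 k \<omega>))) > ereal \<epsilon>} < \<rho>" using j by simp
  qed (use pos q in simp)
qed

theorem theorem1:
  fixes M :: "'w measure"
    and A :: "'i::finite \<Rightarrow> real^'n^'n" and B :: "'i \<Rightarrow> real^'m^'n"
    and r :: "nat \<Rightarrow> 'w \<Rightarrow> 'i" and r0 :: 'i and p :: "'i \<Rightarrow> 'i \<Rightarrow> real"
    and \<pi> :: "'i \<Rightarrow> real"
    and tau :: "nat \<Rightarrow> 'w \<Rightarrow> nat" and mu :: "nat \<Rightarrow> real"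
    and Rt :: "real^'n^'n" and L :: "'i \<Rightarrow> real^'n^'m" and \<zeta> :: "'i \<Rightarrow> 'i \<Rightarrow> real"
  assumes "prob_space M"
    and "stochastic_matrix p"
    and "markov_chain M r r0 p"
    and "irreducible_tm p" and "aperiodic_tm p"
    and "invariant_dist p \<pi>"
    and "prob_space.indep_vars M (\<lambda>_. count_space UNIV) tau {1..}"
    and "\<And>i t. 1 \<le> i \<Longrightarrow> measure M {\<omega>\<in>space M. tau i \<omega> = t} = mu t"
    and "mu 0 = 0"
    and "summable (\<lambda>t. real t * mu t)"
    and "indep_processes M r tau"
    and "transpose Rt = Rt" and "pos_def Rt"
    and "\<And>i j. 0 < \<zeta> i j"
    and "\<And>i j. neg_semidef (transpose (A i ** Rt + B i ** L j) ** matrix_inv Rt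
                               ** (A i ** Rt + B i ** L j) - \<zeta> i j *\<^sub>R Rt)"
    and "(\<Sum>t. mu t * (\<Sum>l\<in>{1..t}. \<Sum>i\<in>UNIV. \<Sum>j\<in>UNIV.
             \<pi> i * mstep p (l - 1) i j * ln (\<zeta> j i))) < 0"
  shows "as_asymp_stable M
           (\<lambda>x0. closed_loop A B (\<lambda>i. L i ** matrix_inv Rt) r tau x0)"
proof -
  interpret sampled_chain M r r0 p \<pi> tau mu
    using assms by (intro sampled_chain.intro sampled_chain_axioms.intro)
  define g where "g j i = ln (\<zeta> j i)" for j i
  define G where "G = (\<Sum>j\<in>UNIV. \<Sum>i\<in>UNIV. \<bar>g j i\<bar>)"
  interpret rewarded_chain M r r0 p \<pi> tau mu g G
  proof
    fix i j
    have "\<bar>g j i\<bar> \<le> (\<Sum>i\<in>UNIV. \<bar>g j i\<bar>)" by (rule member_le_sum) auto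
    also have "\<dots> \<le> G" unfolding G_def by (rule member_le_sum) (auto intro: sum_nonneg)
    finally show "\<bar>g j i\<bar> \<le> G" .
  qed
  \<comment> \<open>The hypothesis counts steps from 1 and uses \<open>l - 1\<close> transitions,
    which is \<open>l < t\<close> here. Its \<open>i\<close> is the mode at the start of the block
    and \<open>j\<close> the current one, so \<open>\<zeta> j i\<close> pairs the current dynamics
    with the gain in use.\<close>
  have "(\<Sum>l\<in>{1..t}. \<Sum>i\<in>UNIV. \<Sum>j\<in>UNIV. \<pi> i * mstep p (l - 1) i j * ln (\<zeta> j i)) = (\<Sum>l<t. stat_reward l)" for t
    by (simp add: sum.atLeast1_atMost_eq stat_reward_def mop_def g_def sum_distrib_left mult.assoc)
  then have "(\<Sum>t. mu t * (\<Sum>l<t. stat_reward l)) < 0" using assms(16) by simp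
  then have lim: "AE \<omega> in M. filterlim (\<lambda>k. reward g (wait \<omega>) (mode \<omega>) k) at_bot sequentially"
    by (rule reward_at_bot)
  define V where "V x = x \<bullet> (matrix_inv Rt *v x)" for x :: "real^'n"
  obtain a b where ab: "0 < a" "0 < b" "\<And>x. a * (norm x)\<^sup>2 \<le> V x" "\<And>x. V x \<le> b * (norm x)\<^sup>2"
    using pos_def_bounds[OF pos_def_matrix_inv(3)[OF assms(13)]] unfolding V_def by metis
  let ?x = "closed_loop A B (\<lambda>i. L i ** matrix_inv Rt) r tau"
  \<comment> \<open>A pathwise bound, valid at every sample point: the one-step factors multiply to
    the exponential of the accumulated logarithms.\<close>
  have V_le: "V (?x x0 k \<omega>) \<le> exp (reward g (wait \<omega>) (mode \<omega>) k) * V x0" for x0 k \<omega>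
  proof (induction k)
    case (Suc k)
    let ?z = "\<zeta> (r k \<omega>) (sampled_mode r tau k \<omega>)"
    have "V (?x x0 (Suc k) \<omega>) \<le> ?z * V (?x x0 k \<omega>)"
      unfolding V_def closed_loop.simps by (rule lyapunov_step[OF assms(13,15)])
    also have "\<dots> \<le> ?z * (exp (reward g (wait \<omega>) (mode \<omega>) k) * V x0)"
      using Suc assms(14) by (intro mult_left_mono) (auto intro: less_imp_le)
    also have "\<dots> = exp (reward g (wait \<omega>) (mode \<omega>) (Suc k)) * V x0"
      using assms(14) by (simp add: reward_def exp_add g_def mode_def sampled_mode_eq[unfolded mode_def])
    finally show ?case .
  qed (simp add: reward_def)
  show ?thesis
  proof (rule as_asymp_stable_of_reward[OF closed_loop_measurable reward_measurable _ _ lim])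
    show "0 < b / a" using ab by simp
    fix x0 k \<omega>
    have "a * (norm (?x x0 k \<omega>))\<^sup>2 \<le> exp (reward g (wait \<omega>) (mode \<omega>) k) * V x0"
      using ab(3) V_le by (rule order_trans)
    also have "\<dots> \<le> exp (reward g (wait \<omega>) (mode \<omega>) k) * (b * (norm x0)\<^sup>2)"
      using ab(4) by (intro mult_left_mono) auto
    finally show "(norm (?x x0 k \<omega>))\<^sup>2 \<le> b / a * exp (reward g (wait \<omega>) (mode \<omega>) k) * (norm x0)\<^sup>2"
      using ab(1) by (simp add: field_simps)
  qed
qed

end
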